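(* Let $(G_a,G_b)\sim ER(n;\mathbf{p})$ where $\mathbf p$ is a function of $n$ with $p_{00}=1-o(1)$, and let $h\in[n]$ with $\omega(\log n)\le h\le o(n)$. If \[ \max\big\{(\log h)^2,\ n(p_{01}+p_{10})\log h\big\}\ \le\ o\!\left(\frac{n\,p_{11}}{h^4\log n}\cdot\frac{p_{11}}{p_{1*}}\right), \] then $\Pr[\mathcal E^{H}\wedge\mathcal E^{S}_a\wedge\mathcal E^{S}_b]\ge 1-o(1)$.
   Context: Correlated Erdős–Rényi model $ER(n;\mathbf{p})$: $G_a,G_b$ are random graphs on the same $n$-vertex set $V$; for each unordered pair $e$ of distinct vertices, independently, $(\mathbf 1[e\in E(G_a)],\mathbf 1[e\in E(G_b)])$ equals $(1,1),(1,0),(0,1),(0,0)$ with probabilities $p_{11},p_{10},p_{01},p_{00}$; $p_{1*}=p_{11}+p_{10}$. For a graph $G$, $\delta_G=(\delta_{G,1},\dots,\delta_{G,n})$ is its degree sequence in decreasing order, $\delta_{a,i}=\delta_{G_a,i}$, $\delta_{b,i}=\delta_{G_b,i}$. $f_h(G)$ is the vector $(w_1,\dots,w_h)$ of distinct vertices with $\deg_G(w_i)=\delta_{G,i}$ (ties broken arbitrarily). Events: $\mathcal E^H$ is the event $f_h(G_a)=f_h(G_b)$; $\mathcal E^S_a$ is the event $\delta_{a,i}>\delta_{a,i+1}+2$ for all $i\in[h]$; $\mathcal E^S_b$ is the same event for $\delta_b$. *)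

theory Defs
  imports Complex_Main "HOL-Library.Landau_Symbols" "HOL-Library.FuncSet"
begin

text \<open>Vertex set V = {0..<n}. Unordered pairs {u,v} are represented as (u,v) with u < v.\<close>
definition edges :: "nat \<Rightarrow> (nat \<times> nat) set" where
  "edges n = {(u, v). u < v \<and> v < n}"

text \<open>Joint law of (1[e in G_a], 1[e in G_b]) for a single pair e.\<close>
definition cell :: "real \<Rightarrow> real \<Rightarrow> real \<Rightarrow> real \<Rightarrow> bool \<times> bool \<Rightarrow> real" where
  "cell p11 p10 p01 p00 x =
     (case x of (True, True) \<Rightarrow> p11 | (True, False) \<Rightarrow> p10
              | (False, True) \<Rightarrow> p01 | (False, False) \<Rightarrow> p00)"

definition er_prob :: "nat \<Rightarrow> real \<Rightarrow> real \<Rightarrow> real \<Rightarrow> real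
    \<Rightarrow> ((nat \<times> nat \<Rightarrow> bool \<times> bool) \<Rightarrow> bool) \<Rightarrow> real" where
  "er_prob n p11 p10 p01 p00 A =
     (\<Sum>\<omega> \<in> PiE (edges n) (\<lambda>_. UNIV).
        if A \<omega> then (\<Prod>e \<in> edges n. cell p11 p10 p01 p00 (\<omega> e)) else 0)"

definition graph_a :: "(nat \<times> nat \<Rightarrow> bool \<times> bool) \<Rightarrow> nat \<Rightarrow> nat \<Rightarrow> bool" where
  "graph_a \<omega> u v = (u \<noteq> v \<and> fst (\<omega> (min u v, max u v)))"

definition graph_b :: "(nat \<times> nat \<Rightarrow> bool \<times> bool) \<Rightarrow> nat \<Rightarrow> nat \<Rightarrow> bool" where
  "graph_b \<omega> u v = (u \<noteq> v \<and> snd (\<omega> (min u v, max u v)))"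

definition deg :: "nat \<Rightarrow> (nat \<Rightarrow> nat \<Rightarrow> bool) \<Rightarrow> nat \<Rightarrow> nat" where
  "deg n G v = card {u. u < n \<and> G u v}"

definition deg_seq :: "nat \<Rightarrow> (nat \<Rightarrow> nat \<Rightarrow> bool) \<Rightarrow> nat \<Rightarrow> nat" where
  "deg_seq n G i =
     (if 1 \<le> i \<and> i \<le> n then rev (sort (map (deg n G) [0..<n])) ! (i - 1) else 0)"

text \<open>ws is an admissible value of f_h(G) (for some tie-breaking).\<close>
definition top_vertices :: "nat \<Rightarrow> (nat \<Rightarrow> nat \<Rightarrow> bool) \<Rightarrow> nat \<Rightarrow> nat list \<Rightarrow> bool" where
  "top_vertices n G h ws =
     (length ws = h \<and> distinct ws \<and> set ws \<subseteq> {..<n} \<and>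
      (\<forall>i < h. deg n G (ws ! i) = deg_seq n G (i + 1)))"

text \<open>Event E^H: f_h(G_a) = f_h(G_b) (the admissible top-h vectors agree).\<close>
definition event_H :: "nat \<Rightarrow> nat \<Rightarrow> (nat \<Rightarrow> nat \<Rightarrow> bool) \<Rightarrow> (nat \<Rightarrow> nat \<Rightarrow> bool) \<Rightarrow> bool" where
  "event_H n h Ga Gb = ({ws. top_vertices n Ga h ws} = {ws. top_vertices n Gb h ws})"

definition event_S :: "nat \<Rightarrow> nat \<Rightarrow> (nat \<Rightarrow> nat \<Rightarrow> bool) \<Rightarrow> bool" where
  "event_S n h G = (\<forall>i \<in> {1..h}. deg_seq n G i > deg_seq n G (i + 1) + 2)"

end

(*
  Let p = p11 + p10 and let X ~ Bin(n - 2, p); the degrees of two vertices of G_a are e + X and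
  e + Y with X, Y independent copies and e the indicator of the edge between them.  Choose K
  maximal with n P(X >= K) >= 4h.  By Chernoff K <= np + 4 sqrt(np log n), and up to a little
  beyond this level the ratio of consecutive point masses is at least 1 - O(sqrt(log n / np)).
  Hence, with M of order sqrt(np / log n), the masses P(X = k) are O(h / (n M)) for all k >= K - M
  up to the maximal degree.  A second moment computation gives more than h vertices of degree at
  least K, and a union bound over pairs separates the degrees above K from all others by s as
  soon as s = o(M / h^2); moreover only O(h) vertices have degree above K - M.

  Conditionally on G_a the degree of v in G_b is a sum of independent indicators of variance
  O(n (p01 + p10)), with a mean that is an increasing function, of slope at least 1/2, of the
  degree in G_a.  Bernstein-type bounds keep the deviations below s/8 for the vertices of degree
  above K - M and below M/8 for all others, so the order of the top h vertices survives with
  gaps larger than 2.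
*)
theory Submission
  imports Defs "HOL-Probability.Product_PMF"
begin

section \<open>Product distributions and concentration\<close>

text \<open>The power \<open>h^4\<close> in the hypothesis is the square of a birthday count. Of
  order \<open>h\<close> vertices have degrees above \<open>K\<close>, spread at scale
  \<open>M\<close>, so two of them come within \<open>s\<close> of each other with probability of
  order \<open>h^2 * s / M\<close>. This is what forces \<open>s\<close> below
  \<open>M / h^2\<close>, a quantity of order sqrt (n p / (h^4 log n)). The noise of the second
  graph at one vertex, with an error probability polynomially small in \<open>h\<close>, has size
  log h + sqrt (n (p01 + p10) log h), and it must stay below \<open>s\<close>. Squaring this
  requirement gives the two terms of the maximum. The level \<open>K\<close> is never computed: it
  is fixed through the size of its tail, and the estimates near it come from ratios of consecutive
  point masses, so no asymptotic formula for binomial tails enters. All estimates hold for a fixed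
  \<open>n\<close> with explicit constants; limits appear only in the final theorem, where an
  eventual bound is shown for each fixed error.\<close>

lemma prob_bind_pmf:
  "measure_pmf.prob (bind_pmf p f) X = measure_pmf.expectation p (\<lambda>x. measure_pmf.prob (f x) X)"
proof -
  have int: "integrable (measure_pmf p) (\<lambda>x. measure_pmf.prob (f x) X)"
    by (intro measure_pmf.integrable_const_bound[of _ 1]) auto
  have "ennreal (measure_pmf.prob (bind_pmf p f) X) = emeasure (measure_pmf (bind_pmf p f)) X"
    by (simp add: measure_pmf.emeasure_eq_measure)
  also have "\<dots> = (\<integral>\<^sup>+x. ennreal (measure_pmf.prob (f x) X) \<partial>measure_pmf p)"
    unfolding emeasure_bind_pmf by (simp add: measure_pmf.emeasure_eq_measure)
  also have "\<dots> = ennreal (measure_pmf.expectation p (\<lambda>x. measure_pmf.prob (f x) X))"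
    by (rule nn_integral_eq_integral[OF int]) auto
  finally show ?thesis
    by (simp add: integral_nonneg_AE)
qed

text \<open>Serves two purposes: with \<open>c = 0\<close> it conditions on one of two counts being
  large, and with \<open>d = 1\<close> it discards the bad outcomes of the first graph at the cost
  of their probability.\<close>

lemma prob_bind_pmf_le:
  assumes "\<And>x. x \<in> set_pmf p \<Longrightarrow> measure_pmf.prob (f x) X \<le> c + d * indicator G x"
  shows "measure_pmf.prob (bind_pmf p f) X \<le> c + d * measure_pmf.prob p G"
proof -
  have "measure_pmf.expectation p (\<lambda>x. measure_pmf.prob (f x) X)
          \<le> measure_pmf.expectation p (\<lambda>x. c + d * indicator G x)"
  proof (rule integral_mono_AE)
    show "integrable (measure_pmf p) (\<lambda>x. measure_pmf.prob (f x) X)"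
      by (intro measure_pmf.integrable_const_bound[of _ 1]) auto
    show "integrable (measure_pmf p) (\<lambda>x. c + d * indicator G x :: real)"
      by (intro measure_pmf.integrable_const_bound[of _ "\<bar>c\<bar> + \<bar>d\<bar>"])
         (auto simp: indicator_def)
  qed (use assms in \<open>auto simp: AE_measure_pmf_iff\<close>)
  also have "\<dots> = c + d * measure_pmf.prob p G"
    by (subst Bochner_Integration.integral_add)
       (auto intro!: measure_pmf.integrable_const_bound[of _ 1] simp: AE_measure_pmf_iff)
  finally show ?thesis by (simp add: prob_bind_pmf)
qed

lemma prob_pair_bernoulli_pmf:
  assumes "0 \<le> p" "p \<le> 1"
  shows "measure_pmf.prob (pair_pmf (bernoulli_pmf p) M) X =
           p * measure_pmf.prob M {y. (True, y) \<in> X} + (1 - p) * measure_pmf.prob M {y. (False, y) \<in> X}"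
proof -
  have "measure_pmf.prob (pair_pmf (bernoulli_pmf p) M) X =
      measure_pmf.prob (bernoulli_pmf p \<bind> (\<lambda>x. map_pmf (Pair x) M)) X"
    by (simp add: pair_pmf_def map_pmf_def)
  also have "\<dots> = p * measure_pmf.prob M {y. (True, y) \<in> X} + (1 - p) * measure_pmf.prob M {y. (False, y) \<in> X}"
    using assms by (subst prob_bind_pmf) (simp add: vimage_def mult.commute)
  finally show ?thesis .
qed

lemma prob_pmf_disj_le:
  "measure_pmf.prob M {x. P x \<or> Q x} \<le> measure_pmf.prob M {x. P x} + measure_pmf.prob M {x. Q x}"
proof -
  have "{x. P x \<or> Q x} = {x. P x} \<union> {x. Q x}" by auto
  thus ?thesis by (simp add: measure_Un_le)
qed

lemma prob_pmf_ex_le: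
  assumes "finite I" "\<And>i. i \<in> I \<Longrightarrow> measure_pmf.prob M {x. P i x} \<le> c"
  shows "measure_pmf.prob M {x. \<exists>i\<in>I. P i x} \<le> real (card I) * c"
proof -
  have "{x. \<exists>i\<in>I. P i x} = (\<Union>i\<in>I. {x. P i x})" by auto
  hence "measure_pmf.prob M {x. \<exists>i\<in>I. P i x} \<le> (\<Sum>i\<in>I. measure_pmf.prob M {x. P i x})"
    using assms(1) by (auto intro!: measure_pmf.finite_measure_subadditive_finite)
  also have "\<dots> \<le> real (card I) * c"
    using assms(2) by (rule sum_bounded_above)
  finally show ?thesis .
qed

lemma prob_pmf_mono:
  "(\<And>x. x \<in> set_pmf M \<Longrightarrow> P x \<Longrightarrow> Q x) \<Longrightarrow> measure_pmf.prob M {x. P x} \<le> measure_pmf.prob M {x. Q x}"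
  by (intro measure_pmf.finite_measure_mono_AE) (auto simp: AE_measure_pmf_iff)

section \<open>Bernstein-type bound for sums of centred Bernoulli variables\<close>

lemma exp_le_quadratic:
  fixes x :: real
  assumes "\<bar>x\<bar> \<le> 1"
  shows "exp x \<le> 1 + x + x\<^sup>2"
proof (cases "x \<ge> 0")
  case True
  thus ?thesis using assms exp_bound by auto
next
  case False
  define y where "y = - x"
  have y: "0 \<le> y" using False by (simp add: y_def)
  \<comment> \<open>The bound on \<open>exp (- y)\<close> is multiplied by the Taylor lower bound of
    \<open>exp y\<close>; all odd and negative contributions cancel in the product, which leaves a
    polynomial with nonnegative coefficients.\<close>
  have "1 \<le> 1 + y\<^sup>2 / 2 + y ^ 3 / 2 + y ^ 4 / 2" using y by simp
  also have "\<dots> = (1 - y + y\<^sup>2) * (1 + y + y\<^sup>2 / 2)"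
    by (simp add: field_simps power2_eq_square power3_eq_cube power4_eq_xxxx)
  also have "\<dots> \<le> (1 - y + y\<^sup>2) * exp y"
  proof (rule mult_left_mono)
    show "1 + y + y\<^sup>2 / 2 \<le> exp y" using exp_lower_Taylor_quadratic[OF y] .
    have "0 \<le> (1 - y / 2)\<^sup>2 + 3 / 4 * y\<^sup>2" by simp
    thus "0 \<le> 1 - y + y\<^sup>2" by (simp add: power2_eq_square algebra_simps)
  qed
  finally have "exp (- y) \<le> 1 - y + y\<^sup>2"
    by (simp add: exp_minus field_simps)
  thus ?thesis by (simp add: y_def)
qed

text \<open>\<open>w\<close> dominates the variance \<open>r * (1 - r)\<close>. The minimum is
  needed because an edge of the first graph survives in the second with probability close to 1,
  where \<open>r\<close> itself would be far too large. Exchanging success and failure, that is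
  \<open>r\<close> with \<open>1 - r\<close> and \<open>t\<close> with \<open>- t\<close>, reduces
  this case to small \<open>r\<close>.\<close>

lemma bernoulli_centred_mgf_le:
  fixes r t w :: real
  assumes r: "0 \<le> r" "r \<le> 1" and t: "\<bar>t\<bar> \<le> 1" and w: "min r (1 - r) \<le> w"
  shows "r * exp (t * (1 - r)) + (1 - r) * exp (t * (0 - r)) \<le> exp (t\<^sup>2 * w)"
proof -
  have *: "r * exp (t * (1 - r)) + (1 - r) * exp (t * (0 - r)) \<le> exp (t\<^sup>2 * w)"
    if "0 \<le> r" "r \<le> 1" "\<bar>t\<bar> \<le> 1" "r \<le> w" for r t w :: real
  proof -
    have "r * exp (t * (1 - r)) + (1 - r) * exp (t * (0 - r)) = exp (- t * r) * (1 + r * (exp t - 1))"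
      by (simp add: algebra_simps exp_diff exp_minus divide_inverse)
    also have "\<dots> \<le> exp (- t * r) * exp (r * (exp t - 1))"
      by (intro mult_left_mono exp_ge_add_one_self) auto
    also have "\<dots> = exp (r * (exp t - 1 - t))" by (simp add: algebra_simps flip: exp_add)
    also have "r * (exp t - 1 - t) \<le> w * t\<^sup>2"
    proof (rule mult_mono)
      show "exp t - 1 - t \<le> t\<^sup>2" using exp_le_quadratic[OF that(3)] by linarith
      show "0 \<le> exp t - 1 - t" using exp_ge_add_one_self[of t] by linarith
    qed (use that in auto)
    finally show ?thesis by (simp add: mult.commute)
  qed
  show ?thesis
  proof (cases "r \<le> w")
    case True
    thus ?thesis using * r t by blast
  next
    case False
    hence "1 - r \<le> w" using w by linarith
    from *[of "1 - r" "-t" w] this r t show ?thesis by (simp add: algebra_simps)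
  qed
qed

lemma Pi_bernoulli_chernoff_exp:
  fixes r w :: "'a \<Rightarrow> real"
  assumes A: "finite A" "S \<subseteq> A" and r: "\<And>e. e \<in> A \<Longrightarrow> 0 \<le> r e \<and> r e \<le> 1"
    and w: "\<And>e. e \<in> S \<Longrightarrow> min (r e) (1 - r e) \<le> w e" "(\<Sum>e\<in>S. w e) \<le> V" and t: "\<bar>t\<bar> \<le> 1"
  shows "measure_pmf.prob (Pi_pmf A d (\<lambda>e. bernoulli_pmf (r e)))
           {b. (\<Sum>e\<in>S. of_bool (b e) - r e) * t \<ge> x} \<le> exp (t\<^sup>2 * V - x)"
proof -
  let ?M = "Pi_pmf A d (\<lambda>e. bernoulli_pmf (r e))"
  \<comment> \<open>Coordinates outside \<open>S\<close> get the factor 1, so that the expectation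
    factorises over the whole index set \<open>A\<close> of the product measure.\<close>
  define g where "g = (\<lambda>e b. if e \<in> S then exp (t * (of_bool b - r e)) else (1 :: real))"
  define F where "F = (\<lambda>b. \<Prod>e\<in>A. g e (b e))"
  have F: "F b = exp ((\<Sum>e\<in>S. of_bool (b e) - r e) * t)" for b
  proof -
    have "F b = (\<Prod>e\<in>S. exp (t * (of_bool (b e) - r e)))"
      unfolding F_def g_def using A by (intro prod.mono_neutral_cong_right) auto
    also have "\<dots> = exp (\<Sum>e\<in>S. t * (of_bool (b e) - r e))"
      by (rule exp_sum[OF finite_subset[OF A(2,1)], symmetric])
    finally show ?thesis by (simp add: sum_distrib_left mult.commute)
  qed
  have intg: "integrable (measure_pmf (bernoulli_pmf (r e))) (g e)" for e
    by (rule integrable_measure_pmf_finite) auto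
  have int: "integrable (measure_pmf ?M) F"
    unfolding F_def using intg A(1) by (intro integrable_prod_Pi_pmf) auto
  have "measure_pmf.expectation ?M F = (\<Prod>e\<in>A. measure_pmf.expectation (bernoulli_pmf (r e)) (g e))"
    unfolding F_def using intg A(1) by (intro expectation_prod_Pi_pmf) (auto simp: g_def)
  also have "\<dots> \<le> (\<Prod>e\<in>A. if e \<in> S then exp (t\<^sup>2 * w e) else 1)"
  proof (rule prod_mono)
    fix e assume e: "e \<in> A"
    have "measure_pmf.expectation (bernoulli_pmf (r e)) (g e) = g e True * r e + g e False * (1 - r e)"
      using r[OF e] by simp
    also have "\<dots> \<le> (if e \<in> S then exp (t\<^sup>2 * w e) else 1)"
      using bernoulli_centred_mgf_le[of "r e" t "w e"] r[OF e] w(1)[of e] t by (auto simp: g_def mult.commute)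
    finally show "0 \<le> measure_pmf.expectation (bernoulli_pmf (r e)) (g e) \<and>
        measure_pmf.expectation (bernoulli_pmf (r e)) (g e) \<le> (if e \<in> S then exp (t\<^sup>2 * w e) else 1)"
      by (auto intro!: integral_nonneg_AE simp: g_def)
  qed
  also have "\<dots> = (\<Prod>e\<in>S. exp (t\<^sup>2 * w e))"
    using A by (intro prod.mono_neutral_cong_right) auto
  also have "\<dots> = exp (t\<^sup>2 * (\<Sum>e\<in>S. w e))"
    by (simp add: exp_sum[OF finite_subset[OF A(2,1)]] sum_distrib_left)
  also have "\<dots> \<le> exp (t\<^sup>2 * V)" using w(2) by (simp add: mult_left_mono)
  finally have E: "measure_pmf.expectation ?M F \<le> exp (t\<^sup>2 * V)" .
  have "measure_pmf.prob ?M {b\<in>space (measure_pmf ?M). F b \<ge> exp x} \<le> measure_pmf.expectation ?M F / exp x"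
    by (intro integral_Markov_inequality_measure[where A = "{}"] int) (auto simp: F)
  also have "\<dots> \<le> exp (t\<^sup>2 * V) / exp x" by (intro divide_right_mono E) auto
  finally show ?thesis by (simp add: F exp_diff)
qed

text \<open>The two conditions on \<open>x\<close> are the Poisson and the Gaussian range of
  Bernstein's inequality. In the applications \<open>c\<close> is \<open>ln n\<close> or
  \<open>ln h\<close>, and the factor 4 yields errors \<open>2 / n^4\<close> and
  \<open>2 / h^4\<close>, small enough for the union bounds.\<close>

lemma Pi_bernoulli_chernoff:
  fixes r w :: "'a \<Rightarrow> real"
  assumes A: "finite A" "S \<subseteq> A" and r: "\<And>e. e \<in> A \<Longrightarrow> 0 \<le> r e \<and> r e \<le> 1"
    and w: "\<And>e. e \<in> S \<Longrightarrow> min (r e) (1 - r e) \<le> w e" "(\<Sum>e\<in>S. w e) \<le> V" 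
    and x: "8 * c \<le> x" "16 * V * c \<le> x\<^sup>2" "0 < c"
  shows "measure_pmf.prob (Pi_pmf A d (\<lambda>e. bernoulli_pmf (r e)))
           {b. \<bar>\<Sum>e\<in>S. of_bool (b e) - r e\<bar> \<ge> x} \<le> 2 * exp (- 4 * c)"
proof -
  let ?M = "Pi_pmf A d (\<lambda>e. bernoulli_pmf (r e))"
  let ?X = "\<lambda>b. \<Sum>e\<in>S. of_bool (b e) - r e"
  \<comment> \<open>With this choice \<open>t * x = 8 * c\<close>, while
    \<open>16 * V * c \<le> x^2\<close> gives \<open>t^2 * V \<le> 4 * c\<close>, so the exponent is
    at most \<open>- 4 * c\<close>; the condition \<open>8 * c \<le> x\<close> is exactly
    \<open>t \<le> 1\<close>.\<close>
  define t where "t = 8 * c / x"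
  have x0: "x > 0" using x by linarith
  have t: "0 < t" "t \<le> 1" using x x0 by (auto simp: t_def field_simps)
  have "t\<^sup>2 * V = 4 * c * (16 * V * c / x\<^sup>2)" by (simp add: t_def power2_eq_square)
  also have "\<dots> \<le> 4 * c * 1" using x x0 by (intro mult_left_mono) (auto simp: field_simps)
  finally have tV: "t\<^sup>2 * V \<le> 4 * c" by simp
  have tx: "t * x = 8 * c" using x0 by (simp add: t_def)
  have one: "measure_pmf.prob ?M {b. 8 * c \<le> ?X b * s} \<le> exp (- 4 * c)" if "s = t \<or> s = - t" for s
  proof -
    have "measure_pmf.prob ?M {b. 8 * c \<le> ?X b * s} \<le> exp (s\<^sup>2 * V - 8 * c)"
      using that t by (intro Pi_bernoulli_chernoff_exp[where w = w] A r w) (use that t in auto)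
    also have "\<dots> \<le> exp (- 4 * c)" using that tV by auto
    finally show ?thesis .
  qed
  have "measure_pmf.prob ?M {b. \<bar>?X b\<bar> \<ge> x} 
      \<le> measure_pmf.prob ?M {b. 8 * c \<le> ?X b * t \<or> 8 * c \<le> ?X b * (- t)}"
  proof (rule prob_pmf_mono)
    fix b assume "\<bar>?X b\<bar> \<ge> x"
    hence "t * \<bar>?X b\<bar> \<ge> 8 * c" using t tx by (metis mult_left_mono less_imp_le)
    thus "8 * c \<le> ?X b * t \<or> 8 * c \<le> ?X b * (- t)"
      by (cases "?X b \<ge> 0") (auto simp: mult.commute)
  qed
  also have "\<dots> \<le> exp (- 4 * c) + exp (- 4 * c)"
    by (rule order_trans[OF prob_pmf_disj_le]) (intro add_mono one; simp)
  finally show ?thesis by simp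
qed

section \<open>Well separated degree sequences\<close>

definition gr :: "(nat \<times> nat \<Rightarrow> bool) \<Rightarrow> nat \<Rightarrow> nat \<Rightarrow> bool" where
  "gr x u v \<longleftrightarrow> u \<noteq> v \<and> x (min u v, max u v)"

text \<open>The coordinates that determine the degree of \<open>v\<close>, oriented as in
  \<open>edges\<close>. Two stars share a single coordinate, the only source of dependence between
  two degrees.\<close>

definition star :: "nat \<Rightarrow> nat \<Rightarrow> (nat \<times> nat) set" where
  "star n v = (\<lambda>w. (min w v, max w v)) ` ({..<n} - {v})"

lemma graph_a_eq_gr: "graph_a \<omega> = gr (\<lambda>e. fst (\<omega> e))"
  and graph_b_eq_gr: "graph_b \<omega> = gr (\<lambda>e. snd (\<omega> e))"
  by (auto simp: fun_eq_iff graph_a_def graph_b_def gr_def)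

lemma finite_edges: "finite (edges n)"
  by (rule finite_subset[of _ "{..<n} \<times> {..<n}"]) (auto simp: edges_def)

lemma star_subset_edges: "v < n \<Longrightarrow> star n v \<subseteq> edges n"
  by (auto simp: star_def edges_def min_def max_def)

lemma finite_star: "finite (star n v)"
  by (simp add: star_def)

lemma inj_on_star: "inj_on (\<lambda>w. (min w v, max w v)) ({..<n} - {v :: nat})"
  by (rule inj_onI) (auto simp: min_def max_def split: if_splits)

lemma card_star: "v < n \<Longrightarrow> card (star n v) = n - 1"
  unfolding star_def by (subst card_image[OF inj_on_star]) auto

lemma star_Int_star: "\<lbrakk>u < n; v < n; u \<noteq> v\<rbrakk> \<Longrightarrow> star n u \<inter> star n v = {(min u v, max u v)}"
proof (intro equalityI subsetI)
  assume *: "u < n" "v < n" "u \<noteq> v"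
  fix e assume "e \<in> {(min u v, max u v)}"
  moreover have "(min u v, max u v) \<in> star n u"
    unfolding star_def using * by (intro image_eqI[of _ _ v]) (auto simp: min.commute max.commute)
  moreover have "(min u v, max u v) \<in> star n v"
    unfolding star_def using * by (intro image_eqI[of _ _ u]) auto
  ultimately show "e \<in> star n u \<inter> star n v" by simp
qed (auto simp: star_def min_def max_def split: if_splits)

lemma deg_gr: "deg n (gr x) v = card {e \<in> star n v. x e}"
proof -
  have "{e \<in> star n v. x e} = (\<lambda>w. (min w v, max w v)) ` {u. u < n \<and> gr x u v}"
    by (auto simp: star_def gr_def)
  thus ?thesis unfolding deg_def
    by (simp, subst card_image) (auto intro: inj_on_subset[OF inj_on_star] simp: gr_def)
qed

text \<open>
  The list \<open>ws\<close> starts the decreasing arrangement of \<open>{..<n}\<close> by \<open>f\<close>, and each of its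
  values exceeds by more than \<open>g\<close> every value that comes later, listed in \<open>ws\<close> or not.
\<close>
definition leads :: "(nat \<Rightarrow> nat) \<Rightarrow> nat \<Rightarrow> nat \<Rightarrow> nat list \<Rightarrow> bool" where
  "leads f n g ws \<longleftrightarrow> distinct ws \<and> set ws \<subseteq> {..<n} \<and>
     (\<forall>i<length ws. \<forall>v<n. v \<notin> set (take (Suc i) ws) \<longrightarrow> f v + g < f (ws ! i))"

lemma leads_exists:
  fixes f :: "nat \<Rightarrow> nat"
  assumes "h < card {v. v < n \<and> K \<le> f v}"
    and sep: "\<And>u v. \<lbrakk>u < n; v < n; u \<noteq> v; K \<le> f u; f v \<le> f u\<rbrakk> \<Longrightarrow> f v + g < f u"
  shows "\<exists>ws. length ws = h \<and> leads f n g ws \<and> (\<forall>u\<in>set ws. K \<le> f u)"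
  using assms(1)
proof (induction h)
  case 0
  show ?case by (auto simp: leads_def)
next
  case (Suc h)
  then obtain ws where ws: "length ws = h" "leads f n g ws" "\<forall>u\<in>set ws. K \<le> f u" by auto
  let ?R = "{..<n} - set ws"
  have "\<not> {v. v < n \<and> K \<le> f v} \<subseteq> set ws"
  proof
    assume "{v. v < n \<and> K \<le> f v} \<subseteq> set ws"
    hence "card {v. v < n \<and> K \<le> f v} \<le> length ws"
      by (metis List.finite_set card_length card_mono le_trans)
    thus False using Suc.prems ws(1) by simp
  qed
  then obtain y where y: "y \<in> ?R" "K \<le> f y" by auto
  have "Max (f ` ?R) \<in> f ` ?R" using y by (intro Max_in) auto
  then obtain x where x: "x \<in> ?R" "f x = Max (f ` ?R)" by auto
  have max: "f v \<le> f x" if "v \<in> ?R" for v using that x by simp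
  have Kx: "K \<le> f x" using max[OF y(1)] y(2) by simp
  have "leads f n g (ws @ [x])"
    unfolding leads_def
  proof (intro conjI allI impI)
    show "distinct (ws @ [x])" "set (ws @ [x]) \<subseteq> {..<n}"
      using ws(2) x by (auto simp: leads_def)
    fix i v assume i: "i < length (ws @ [x])" and v: "v < n" "v \<notin> set (take (Suc i) (ws @ [x]))"
    show "f v + g < f ((ws @ [x]) ! i)"
    proof (cases "i < h")
      case True
      thus ?thesis using ws v i by (auto simp: leads_def nth_append)
    next
      case False
      hence "i = length ws" using i ws by simp
      thus ?thesis using v x max sep[of x v] Kx by auto
    qed
  qed
  thus ?case using ws Kx by (intro exI[of _ "ws @ [x]"]) auto
qed

lemma leads_strict:
  assumes "leads f n g ws" "j < i" "i < length ws"
  shows "f (ws ! i) + g < f (ws ! j)"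
proof -
  have "ws ! i \<notin> set (take (Suc j) ws)"
    using assms by (auto simp: leads_def in_set_conv_nth nth_eq_iff_index_eq)
  thus ?thesis using assms by (auto simp: leads_def subset_iff)
qed

text \<open>Evaluates \<open>deg_seq\<close> at the positions covered by \<open>ws\<close> and at
  the next one, whatever ties occur among the remaining vertices.\<close>

lemma leads_sort:
  assumes "leads f n g ws"
  shows "rev (sort (map f [0..<n])) = map f ws @ rev (sort (map f (filter (\<lambda>v. v \<notin> set ws) [0..<n])))"
proof -
  let ?r = "filter (\<lambda>v. v \<notin> set ws) [0..<n]"
  have ws: "distinct ws" "set ws \<subseteq> {..<n}" using assms by (auto simp: leads_def)
  have m: "mset [0..<n] = mset ws + mset ?r"
  proof -
    have "mset (filter (\<lambda>v. v \<in> set ws) [0..<n]) = mset ws"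
      using ws by (subst set_eq_iff_mset_eq_distinct[symmetric]) auto
    thus ?thesis by (metis mset_filter multiset_partition)
  qed
  have "sort (map f [0..<n]) = sort (map f ?r) @ rev (map f ws)"
  proof (rule properties_for_sort)
    show "mset (sort (map f ?r) @ rev (map f ws)) = mset (map f [0..<n])"
      by (simp only: mset_append mset_sort mset_map mset_rev m image_mset_union add.commute)
    have "sorted (rev (map f ws))"
      unfolding sorted_rev_iff_nth_mono
    proof (intro allI impI)
      fix j i assume "j \<le> i" "i < length (map f ws)"
      thus "map f ws ! i \<le> map f ws ! j"
        using leads_strict[OF assms, of j i] by (cases "j = i") auto
    qed
    moreover have "f v \<le> f u" if "v \<in> set ?r" "u \<in> set ws" for u v
    proof -
      obtain i where i: "i < length ws" "u = ws ! i" using \<open>u \<in> set ws\<close> by (auto simp: in_set_conv_nth)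
      have "v \<notin> set (take (Suc i) ws)" using that by (auto dest: in_set_takeD)
      hence "f v + g < f u" using assms i that by (auto simp: leads_def)
      thus ?thesis by simp
    qed
    ultimately show "sorted (sort (map f ?r) @ rev (map f ws))"
      by (auto simp: sorted_append)
  qed
  thus ?thesis by simp
qed

lemma leads_deg_seq:
  assumes "leads (deg n G) n g ws" "i < length ws" "length ws \<le> n"
  shows "deg_seq n G (Suc i) = deg n G (ws ! i)"
  using assms leads_sort[OF assms(1)] by (simp add: deg_seq_def nth_append)

lemma leads_event_S:
  assumes "leads (deg n G) n 2 ws" "length ws < n"
  shows "event_S n (length ws) G"
  unfolding event_S_def
proof
  let ?r = "filter (\<lambda>v. v \<notin> set ws) [0..<n]"
  fix i assume "i \<in> {1..length ws}"
  then obtain j where j: "i = Suc j" "j < length ws" by (cases i) auto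
  show "deg_seq n G i > deg_seq n G (i + 1) + 2"
  proof (cases "Suc j < length ws")
    case True
    thus ?thesis using leads_strict[OF assms(1), of j "Suc j"] j assms
      by (simp add: leads_deg_seq)
  next
    case False
    hence jl: "Suc j = length ws" using j by simp
    \<comment> \<open>The gap after the last listed vertex compares with the largest remaining
      degree. Since \<open>length ws < n\<close>, position \<open>length ws + 1\<close> holds an
      actual degree and not the default 0 of \<open>deg_seq\<close>.\<close>
    let ?l = "rev (sort (map (deg n G) ?r))"
    have "length (rev (sort (map (deg n G) [0..<n]))) = length ws + length ?l"
      by (subst leads_sort[OF assms(1)]) simp
    moreover have "length (rev (sort (map (deg n G) [0..<n]))) = n" by simp
    ultimately have "0 < length ?l" using assms(2) by linarith
    hence "?l ! 0 \<in> set ?l" by (rule nth_mem)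
    moreover have "deg_seq n G (i + 1) = ?l ! 0"
      using assms j jl leads_sort[OF assms(1)] by (simp add: deg_seq_def nth_append)
    ultimately obtain v where v: "v < n" "v \<notin> set ws" "deg_seq n G (i + 1) = deg n G v" by auto
    have "v \<notin> set (take (Suc j) ws)" using v by (auto dest: in_set_takeD)
    thus ?thesis using assms(1) v j leads_deg_seq[OF assms(1) j(2)] assms(2) by (auto simp: leads_def)
  qed
qed

text \<open>A vertex with the degree of \<open>ws ! i\<close> cannot lie outside the first
  \<open>i + 1\<close> entries, because all others are smaller, nor among the first
  \<open>i\<close>, because those are larger. With a unique admissible vector in each graph,
  \<open>event_H\<close> only needs one list that leads in both.\<close>

lemma leads_top_vertices_iff:
  assumes "leads (deg n G) n g ws" "length ws \<le> n"
  shows "top_vertices n G (length ws) ws' \<longleftrightarrow> ws' = ws"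
proof
  assume "ws' = ws"
  thus "top_vertices n G (length ws) ws'"
    using assms leads_deg_seq[OF assms(1)] by (auto simp: top_vertices_def leads_def)
next
  assume t: "top_vertices n G (length ws) ws'"
  show "ws' = ws"
  proof (rule nth_equalityI)
    show "length ws' = length ws" using t by (simp add: top_vertices_def)
    fix i assume i: "i < length ws'"
    have "ws' ! i < n" using t i by (auto simp: top_vertices_def subset_iff)
    have eq: "deg n G (ws' ! i) = deg n G (ws ! i)" and il: "i < length ws"
      using t i leads_deg_seq[OF assms(1) _ assms(2)] by (auto simp: top_vertices_def)
    have "ws' ! i \<in> set (take (Suc i) ws)"
    proof (rule ccontr)
      assume "ws' ! i \<notin> set (take (Suc i) ws)"
      hence "deg n G (ws' ! i) + g < deg n G (ws ! i)"
        using assms(1) il \<open>ws' ! i < n\<close> by (auto simp: leads_def)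
      thus False using eq by simp
    qed
    then obtain j where j: "j \<le> i" "ws' ! i = ws ! j"
      using il by (auto simp: in_set_conv_nth less_Suc_eq_le)
    show "ws' ! i = ws ! i"
    proof (cases "j = i")
      case False
      hence "j < i" using j by simp
      from leads_strict[OF assms(1) this il] show ?thesis using eq j by simp
    qed (use j in simp)
  qed
qed

lemma leads_events:
  assumes "leads (deg n Ga) n 2 ws" "leads (deg n Gb) n 2 ws" "length ws < n"
  shows "event_H n (length ws) Ga Gb \<and> event_S n (length ws) Ga \<and> event_S n (length ws) Gb"
  using assms by (auto simp: event_H_def leads_top_vertices_iff leads_event_S)

section \<open>Local regularity of binomial tails\<close>

text \<open>Written without division so that it also covers \<open>k \<ge> N\<close>, where both
  sides vanish.\<close>

lemma pmf_binomial_Suc_ratio: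
  fixes p :: real
  assumes "0 \<le> p" "p \<le> 1"
  shows "real (Suc k) * (1 - p) * pmf (binomial_pmf N p) (Suc k) = (real N - real k) * p * pmf (binomial_pmf N p) k"
proof (cases "k < N")
  case True
  have "Suc k * (N choose Suc k) = (N - k) * (N choose k)"
    using binomial_absorption[of k N] binomial_absorb_comp[of N k] by simp
  hence c: "real (Suc k) * real (N choose Suc k) = (real N - real k) * real (N choose k)"
    using True by (metis less_imp_le of_nat_diff of_nat_mult)
  obtain m where m: "N - k = Suc m" "N - Suc k = m" using True by (metis Suc_diff_Suc)
  have "real (Suc k) * (1 - p) * pmf (binomial_pmf N p) (Suc k)
       = (real (Suc k) * real (N choose Suc k)) * (p ^ Suc k * (1 - p) ^ Suc m)"
    using assms m by (simp add: algebra_simps del: of_nat_Suc)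
  also have "\<dots> = (real N - real k) * p * pmf (binomial_pmf N p) k"
    unfolding c using assms m by (simp add: algebra_simps)
  finally show ?thesis .
next
  case False
  thus ?thesis using assms by (cases "k = N") (auto simp: binomial_eq_0)
qed

text \<open>The ratio of consecutive masses drops below 1 only through the excess of
  \<open>k\<close> over the mean. As \<open>1 - p \<ge> 1/2\<close>, a relative excess of
  \<open>\<eta> / 2\<close> costs at most \<open>\<eta>\<close>.\<close>

lemma pmf_binomial_Suc_ge:
  fixes p \<eta> :: real
  assumes p: "0 \<le> p" "p \<le> 1/2" and \<eta>: "0 \<le> \<eta>" and k: "real (Suc k) \<le> real N * p * (1 + \<eta> / 2)"
  shows "(1 - \<eta>) * pmf (binomial_pmf N p) k \<le> pmf (binomial_pmf N p) (Suc k)"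
proof -
  let ?b = "pmf (binomial_pmf N p)"
  define K where "K = real (Suc k)"
  have K: "K > 0" "real k = K - 1" by (auto simp: K_def)
  have "0 \<le> real N * p - K + \<eta> * (K * (1 - p))"
  proof (cases "K \<le> real N * p")
    case True
    thus ?thesis using p \<eta> K by simp
  next
    case False
    have "K - real N * p \<le> \<eta> * (real N * p * (1 / 2))" using k by (simp add: K_def algebra_simps)
    also have "\<dots> \<le> \<eta> * (K * (1 - p))"
      using False p \<eta> by (intro mult_left_mono mult_mono) (use K in auto)
    finally show ?thesis by simp
  qed
  hence "(1 - \<eta>) * (K * (1 - p)) \<le> (real N - real k) * p"
    using p by (simp add: K(2) algebra_simps)
  hence "(1 - \<eta>) * (K * (1 - p)) * ?b k \<le> (real N - real k) * p * ?b k"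
    by (intro mult_right_mono) auto
  also have "\<dots> = K * (1 - p) * ?b (Suc k)"
    using pmf_binomial_Suc_ratio[of p k N] p unfolding K_def by linarith
  finally have "K * (1 - p) * ((1 - \<eta>) * ?b k) \<le> K * (1 - p) * ?b (Suc k)"
    by (simp add: algebra_simps)
  moreover have "0 < K * (1 - p)" using K p by simp
  ultimately show ?thesis by (metis mult_le_cancel_left_pos)
qed

lemma pmf_binomial_add_ge_half:
  fixes p \<eta> :: real
  assumes p: "0 \<le> p" "p \<le> 1/2" and \<eta>: "0 \<le> \<eta>" "\<eta> \<le> 1" "real j * \<eta> \<le> 1/2"
    and k: "real (k + j) \<le> real N * p * (1 + \<eta> / 2)"
  shows "pmf (binomial_pmf N p) k \<le> 2 * pmf (binomial_pmf N p) (k + j)"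
proof -
  let ?b = "pmf (binomial_pmf N p)"
  have "(1 - \<eta>) ^ j * ?b k \<le> ?b (k + j)"
    using k
  proof (induction j)
    case (Suc j)
    have "(1 - \<eta>) ^ Suc j * ?b k \<le> (1 - \<eta>) * ?b (k + j)"
      using Suc \<eta> by (simp add: mult.assoc mult_left_mono)
    also have "\<dots> \<le> ?b (k + Suc j)"
      using pmf_binomial_Suc_ge[OF p \<eta>(1), of "k + j" N] Suc.prems by simp
    finally show ?case .
  qed simp
  moreover have "1 / 2 \<le> (1 - \<eta>) ^ j"
    using Bernoulli_inequality[of "- \<eta>" j] \<eta> by simp
  hence "1 / 2 * ?b k \<le> (1 - \<eta>) ^ j * ?b k" by (intro mult_right_mono) auto
  ultimately show ?thesis by simp
qed

lemma prob_pmf_finite_le: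
  assumes "finite A" "\<And>x. x \<in> A \<Longrightarrow> pmf M x \<le> c"
  shows "measure_pmf.prob M A \<le> real (card A) * c"
  using assms by (simp add: measure_measure_pmf_finite sum_bounded_above)

text \<open>
  Up to level \<open>l + 1\<close> the point masses lose at most a factor 2 over \<open>M\<close> consecutive steps.
  Hence a point mass is at most \<open>2 / M\<close> times the tail above it, and a bound on the tail
  beyond \<open>K\<close> propagates \<open>M\<close> steps downwards.
\<close>
context
  fixes N M K l :: nat and p \<eta> \<tau> :: real
  assumes p: "0 \<le> p" "p \<le> 1/2" and \<eta>: "0 \<le> \<eta>" "\<eta> \<le> 1" "real M * \<eta> \<le> 1/2" and M: "0 < M"
    and l: "K \<le> l" "real (l + 1 + M) \<le> real N * p * (1 + \<eta> / 2)"
    and \<tau>: "measure_pmf.prob (binomial_pmf N p) {Suc K..} \<le> \<tau>"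
begin

lemma pmf_binomial_le_tail:
  assumes "k \<le> l + 1"
  shows "real M * pmf (binomial_pmf N p) k \<le> 2 * measure_pmf.prob (binomial_pmf N p) {k..}"
proof -
  let ?b = "pmf (binomial_pmf N p)"
  have "real M * ?b k = (\<Sum>j<M. ?b k)" by simp
  also have "\<dots> \<le> (\<Sum>j<M. 2 * ?b (k + j))"
  proof (rule sum_mono)
    fix j assume j: "j \<in> {..<M}"
    have "real j * \<eta> \<le> real M * \<eta>" using j \<eta> by (intro mult_right_mono) auto
    moreover have "real (k + j) \<le> real (l + 1 + M)" using j assms by simp
    ultimately show "?b k \<le> 2 * ?b (k + j)"
      using p \<eta> l by (intro pmf_binomial_add_ge_half[of p \<eta>]) linarith+
  qed
  also have "\<dots> = 2 * measure_pmf.prob (binomial_pmf N p) ((\<lambda>j. k + j) ` {..<M})"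
    by (simp add: measure_measure_pmf_finite sum_distrib_left sum.reindex)
  also have "\<dots> \<le> 2 * measure_pmf.prob (binomial_pmf N p) {k..}"
    by (intro mult_left_mono measure_pmf.finite_measure_mono) auto
  finally show ?thesis .
qed

lemma pmf_binomial_near_le:
  assumes k: "k \<le> l + 1" "Suc K \<le> k + M"
  shows "pmf (binomial_pmf N p) k \<le> 4 * \<tau> / real M"
proof -
  let ?b = "pmf (binomial_pmf N p)"
  have above: "?b k \<le> 2 * \<tau> / real M" if "k \<le> l + 1" "K < k" for k
  proof -
    have "real M * ?b k \<le> 2 * measure_pmf.prob (binomial_pmf N p) {k..}"
      by (rule pmf_binomial_le_tail[OF that(1)])
    also have "\<dots> \<le> 2 * measure_pmf.prob (binomial_pmf N p) {Suc K..}"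
      using that by (intro mult_left_mono measure_pmf.finite_measure_mono) auto
    finally show ?thesis using \<tau> M by (simp add: field_simps)
  qed
  have "0 \<le> \<tau>" by (rule order_trans[OF measure_nonneg \<tau>])
  show ?thesis
  proof (cases "K < k")
    case True
    have "2 * \<tau> / real M \<le> 4 * \<tau> / real M"
      using \<open>0 \<le> \<tau>\<close> by (intro divide_right_mono) auto
    thus ?thesis using above[OF k(1) True] by linarith
  next
    case False
    \<comment> \<open>The tail bound starts only at \<open>Suc K\<close>, so a mass at or below
      \<open>K\<close> is first compared with the mass at \<open>Suc K\<close>; this second
      comparison turns the factor 2 into 4.\<close>
    define j where "j = Suc K - k"
    have j: "j \<le> M" "k + j = Suc K" using k False by (auto simp: j_def)
    have "real j * \<eta> \<le> real M * \<eta>" using j \<eta> by (intro mult_right_mono) auto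
    hence j\<eta>: "real j * \<eta> \<le> 1 / 2" using \<eta>(3) by linarith
    have "real (k + j) \<le> real (l + 1 + M)" using j l by simp
    hence "real (k + j) \<le> real N * p * (1 + \<eta> / 2)" using l(2) by linarith
    hence "?b k \<le> 2 * ?b (Suc K)"
      using pmf_binomial_add_ge_half[OF p \<eta>(1,2) j\<eta>, of k N] unfolding j(2) by blast
    also have "\<dots> \<le> 2 * (2 * \<tau> / real M)" using above[of "Suc K"] l by simp
    finally show ?thesis by simp
  qed
qed

lemma prob_binomial_near_le:
  "measure_pmf.prob (binomial_pmf N p) {k. Suc K \<le> k + M} \<le> 5 * \<tau>"
proof -
  let ?P = "measure_pmf.prob (binomial_pmf N p)"
  let ?W = "{Suc K - M..<Suc K}"
  have "?P {k. Suc K \<le> k + M} \<le> ?P (?W \<union> {Suc K..})"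
    by (intro measure_pmf.finite_measure_mono) auto
  also have "\<dots> \<le> ?P ?W + ?P {Suc K..}" by (intro measure_Un_le) auto
  also have "?P ?W \<le> real (card ?W) * (4 * \<tau> / real M)"
    using l by (intro prob_pmf_finite_le pmf_binomial_near_le) auto
  also have "\<dots> \<le> real M * (4 * \<tau> / real M)"
    using order_trans[OF measure_nonneg \<tau>]
    by (intro mult_right_mono divide_nonneg_nonneg) auto
  also have "\<dots> = 4 * \<tau>" using M by simp
  finally show ?thesis using \<tau> by simp
qed

end

text \<open>In the application \<open>A\<close> and \<open>B\<close> are two stars without their
  common edge \<open>e0\<close>. The product measure is restricted to the coordinates that are read
  and then split into three independent blocks.\<close>

lemma Pi_bernoulli_counts:
  assumes E: "finite E" "e0 \<in> E" "A \<subseteq> E" "B \<subseteq> E" "e0 \<notin> A" "e0 \<notin> B" "A \<inter> B = {}"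
    and N: "card A = N" "card B = N" and p: "0 \<le> p" "p \<le> 1"
  shows "map_pmf (\<lambda>a. (a e0, card {e \<in> A. a e}, card {e \<in> B. a e})) (Pi_pmf E d (\<lambda>_. bernoulli_pmf p))
       = pair_pmf (bernoulli_pmf p) (pair_pmf (binomial_pmf N p) (binomial_pmf N p))"
proof -
  let ?P = "\<lambda>S. Pi_pmf S d (\<lambda>_. bernoulli_pmf p)"
  let ?f = "\<lambda>a. (a e0, card {e \<in> A. a e}, card {e \<in> B. a e})"
  let ?S = "insert e0 (A \<union> B)"
  have fin: "finite A" "finite B" using E(1,3,4) by (auto intro: finite_subset)
  have "map_pmf ?f (?P E) = map_pmf ?f (map_pmf (\<lambda>f x. if x \<in> ?S then f x else d) (?P E))"
    unfolding pmf.map_comp by (intro map_pmf_cong) (auto intro!: arg_cong[of _ _ card])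
  also have "\<dots> = map_pmf ?f (?P ?S)"
    using E by (subst Pi_pmf_subset[of E]) auto
  also have "?P ?S = map_pmf (\<lambda>(y, f). f(e0 := y)) (pair_pmf (bernoulli_pmf p) (?P (A \<union> B)))"
    using E fin by (intro Pi_pmf_insert) auto
  also have "?P (A \<union> B) = map_pmf (\<lambda>(f, g) x. if x \<in> A then f x else g x) (pair_pmf (?P A) (?P B))"
    using E fin by (intro Pi_pmf_union) auto
  also have "map_pmf ?f (map_pmf (\<lambda>(y, f). f(e0 := y)) (pair_pmf (bernoulli_pmf p)
       (map_pmf (\<lambda>(f, g) x. if x \<in> A then f x else g x) (pair_pmf (?P A) (?P B)))))
     = map_pmf (\<lambda>(y, f, g). (y, card {e \<in> A. f e}, card {e \<in> B. g e}))
         (pair_pmf (bernoulli_pmf p) (pair_pmf (?P A) (?P B)))"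
    unfolding pair_map_pmf2 pmf.map_comp using E
    by (intro map_pmf_cong) (auto intro!: arg_cong[of _ _ card] split: if_splits)
  also have "\<dots> = pair_pmf (bernoulli_pmf p)
       (pair_pmf (map_pmf (\<lambda>f. card {e \<in> A. f e}) (?P A)) (map_pmf (\<lambda>f. card {e \<in> B. f e}) (?P B)))"
    unfolding pair_map_pmf1 pair_map_pmf2 pmf.map_comp by (intro map_pmf_cong) (auto simp: o_def)
  also have "map_pmf (\<lambda>f. card {e \<in> A. f e}) (?P A) = binomial_pmf N p"
    using fin N p by (intro binomial_pmf_altdef'[symmetric]) auto
  also have "map_pmf (\<lambda>f. card {e \<in> B. f e}) (?P B) = binomial_pmf N p"
    using fin N p by (intro binomial_pmf_altdef'[symmetric]) auto
  finally show ?thesis .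
qed

section \<open>Degrees in a single random graph\<close>

abbreviation er_pmf :: "nat \<Rightarrow> real \<Rightarrow> (nat \<times> nat \<Rightarrow> bool) pmf" where
  "er_pmf n p \<equiv> Pi_pmf (edges n) False (\<lambda>_. bernoulli_pmf p)"

lemma integrable_er_pmf: "integrable (er_pmf n p) (f :: _ \<Rightarrow> real)"
  by (rule integrable_measure_pmf_finite, subst set_Pi_pmf)
     (auto simp: finite_edges intro!: finite_PiE_dflt)

lemma sum_indicator_eq_card: "(\<Sum>v<(n :: nat). indicat_real (S v) x) = real (card {v. v < n \<and> x \<in> S v})"
proof -
  have "(\<Sum>v<n. indicat_real (S v) x) = (\<Sum>v \<in> {v. v < n \<and> x \<in> S v}. 1)"
    by (intro sum.mono_neutral_cong_right) (auto simp: indicator_def)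
  thus ?thesis by simp
qed

text \<open>Conditioning on the edge between \<open>u\<close> and \<open>v\<close> leaves two
  independent counts, both raised by one if the edge is present. The tail and closeness estimates
  below are instances of \<open>Q\<close>.\<close>

lemma prob_deg_pair:
  fixes p :: real and n :: nat
  defines "X \<equiv> binomial_pmf (n - 2) p"
  assumes uv: "u < n" "v < n" "u \<noteq> v" and p: "0 \<le> p" "p \<le> 1"
  shows "measure_pmf.prob (er_pmf n p) {a. Q (deg n (gr a) u) (deg n (gr a) v)} =
           p * measure_pmf.prob (pair_pmf X X) {(x, y). Q (Suc x) (Suc y)} +
           (1 - p) * measure_pmf.prob (pair_pmf X X) {(x, y). Q x y}"
proof -
  define e0 where "e0 = (min u v, max u v)"
  define A where "A = star n u - {e0}"
  define B where "B = star n v - {e0}"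
  have e0: "e0 \<in> star n u" "e0 \<in> star n v" using star_Int_star[OF uv] by (auto simp: e0_def)
  have S: "star n u = insert e0 A" "star n v = insert e0 B" using e0 by (auto simp: A_def B_def)
  have fin: "finite A" "finite B" by (auto simp: A_def B_def finite_star)
  have deg: "deg n (gr a) u = of_bool (a e0) + card {e \<in> A. a e}"
            "deg n (gr a) v = of_bool (a e0) + card {e \<in> B. a e}" for a
  proof -
    have "card {e \<in> insert e0 C. a e} = of_bool (a e0) + card {e \<in> C. a e}"
      if "finite C" "e0 \<notin> C" for C
    proof -
      have "{e \<in> insert e0 C. a e} = (if a e0 then insert e0 {e \<in> C. a e} else {e \<in> C. a e})"
        by auto
      thus ?thesis using that by simp
    qed
    moreover have "e0 \<notin> A" "e0 \<notin> B" by (auto simp: A_def B_def)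
    ultimately show "deg n (gr a) u = of_bool (a e0) + card {e \<in> A. a e}"
         "deg n (gr a) v = of_bool (a e0) + card {e \<in> B. a e}"
      using fin unfolding deg_gr S by blast+
  qed
  have law: "map_pmf (\<lambda>a. (a e0, card {e \<in> A. a e}, card {e \<in> B. a e})) (er_pmf n p)
      = pair_pmf (bernoulli_pmf p) (pair_pmf X X)"
    unfolding X_def
  proof (rule Pi_bernoulli_counts)
    show "e0 \<in> edges n" "A \<subseteq> edges n" "B \<subseteq> edges n"
      using e0 star_subset_edges[OF uv(1)] star_subset_edges[OF uv(2)] by (auto simp: A_def B_def)
    show "A \<inter> B = {}" using star_Int_star[OF uv] by (auto simp: A_def B_def e0_def)
    show "card A = n - 2" "card B = n - 2"
      using e0 by (simp_all add: A_def B_def card_star uv)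
  qed (use p in \<open>auto simp: finite_edges A_def B_def\<close>)
  let ?Z = "{(b, x, y). Q (of_bool b + x) (of_bool b + y)}"
  have "measure_pmf.prob (er_pmf n p) {a. Q (deg n (gr a) u) (deg n (gr a) v)} =
        measure_pmf.prob (pair_pmf (bernoulli_pmf p) (pair_pmf X X)) ?Z"
    unfolding law[symmetric] measure_map_pmf by (simp add: deg vimage_def)
  also have "\<dots> = p * measure_pmf.prob (pair_pmf X X) {(x, y). Q (Suc x) (Suc y)} +
           (1 - p) * measure_pmf.prob (pair_pmf X X) {(x, y). Q x y}"
    using p by (subst prob_pair_bernoulli_pmf) (auto simp: case_prod_unfold)
  finally show ?thesis .
qed

section \<open>Tails, near coincidences and numbers of vertices of large degree\<close>

context
  fixes n :: nat and p :: real and X :: "nat pmf" and T :: "nat \<Rightarrow> real"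
  assumes n: "2 \<le> n" and p: "0 \<le> p" "p \<le> 1"
  defines "X \<equiv> binomial_pmf (n - 2) p"
  defines "T \<equiv> \<lambda>k. measure_pmf.prob X {k..}"
begin

lemma prob_deg_pair_tail:
  assumes uv: "u < n" "v < n" "u \<noteq> v"
  shows "measure_pmf.prob (er_pmf n p) {a. k \<le> deg n (gr a) u \<and> k \<le> deg n (gr a) v} =
           p * (T (k - 1))\<^sup>2 + (1 - p) * (T k)\<^sup>2"
proof -
  \<comment> \<open>Truncated subtraction is correct here: for \<open>k = 0\<close> both sides are
    the whole space.\<close>
  have 1: "{(x, y). k \<le> Suc x \<and> k \<le> Suc y} = {k - 1..} \<times> {k - 1..}" by auto
  have 2: "{(x, y). k \<le> x \<and> k \<le> y} = {k..} \<times> {k..}" by auto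
  show ?thesis
    unfolding prob_deg_pair[where Q = "\<lambda>x y. k \<le> x \<and> k \<le> y", OF uv p] X_def[symmetric] 1 2
    by (simp add: measure_pmf_prob_product T_def power2_eq_square)
qed

lemma prob_deg_tail:
  assumes u: "u < n"
  shows "measure_pmf.prob (er_pmf n p) {a. k \<le> deg n (gr a) u} = p * T (k - 1) + (1 - p) * T k"
proof -
  \<comment> \<open>An arbitrary second vertex, so that the pair law applies with a predicate that
    ignores it.\<close>
  obtain v where v: "v < n" "u \<noteq> v"
    using n that[of "if u = 0 then 1 else 0"] by (auto split: if_splits)
  have 1: "{(x, y :: nat). k \<le> Suc x} = {k - 1..} \<times> UNIV" by auto
  have 2: "{(x, y :: nat). k \<le> x} = {k..} \<times> UNIV" by auto
  show ?thesis
    unfolding prob_deg_pair[where Q = "\<lambda>x y. k \<le> x", OF u v p] X_def[symmetric] 1 2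
    by (simp add: measure_pmf_prob_product T_def)
qed

lemma binomial_tail_antimono: "i \<le> j \<Longrightarrow> T j \<le> T i"
  unfolding T_def by (intro measure_pmf.finite_measure_mono) auto

lemma binomial_tail_pred_le: "T (k - 1) - T k \<le> pmf X (k - 1)"
proof (cases k)
  case (Suc j)
  have "{j..} = {j} \<union> {Suc j..}" by auto
  hence "T j \<le> measure_pmf.prob X {j} + T (Suc j)"
    unfolding T_def by (simp only:) (rule measure_Un_le; simp)
  thus ?thesis by (simp add: Suc measure_pmf_single)
qed (simp add: T_def)

lemma prob_deg_tail_bounds:
  assumes "u < n"
  shows "T k \<le> measure_pmf.prob (er_pmf n p) {a. k \<le> deg n (gr a) u}"
    and "measure_pmf.prob (er_pmf n p) {a. k \<le> deg n (gr a) u} \<le> T (k - 1)"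
proof -
  have T: "T k \<le> T (k - 1)" by (rule binomial_tail_antimono) simp
  have "T k + p * (T (k - 1) - T k) = p * T (k - 1) + (1 - p) * T k"
       "T (k - 1) - (1 - p) * (T (k - 1) - T k) = p * T (k - 1) + (1 - p) * T k"
    by (simp_all add: algebra_simps)
  moreover have "0 \<le> p * (T (k - 1) - T k)" "0 \<le> (1 - p) * (T (k - 1) - T k)"
    using T p by auto
  ultimately show "T k \<le> measure_pmf.prob (er_pmf n p) {a. k \<le> deg n (gr a) u}"
    "measure_pmf.prob (er_pmf n p) {a. k \<le> deg n (gr a) u} \<le> T (k - 1)"
    unfolding prob_deg_tail[OF assms] by linarith+
qed

text \<open>Once the first count is fixed, the second lies in an interval of
  \<open>2 * s + 1\<close> integers, each of mass at most \<open>\<beta>\<close>. The set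
  \<open>Z\<close> contains the configurations with and without the common edge, which is why it
  starts at \<open>K - 1\<close>. The cap \<open>l\<close> keeps the second count where point masses
  are controlled.\<close>

lemma prob_deg_close:
  assumes uv: "u < n" "v < n" "u \<noteq> v" and \<beta>: "\<And>y. \<lbrakk>K \<le> y + s + 1; y \<le> l\<rbrakk> \<Longrightarrow> pmf X y \<le> \<beta>" "0 \<le> \<beta>"
  shows "measure_pmf.prob (er_pmf n p) {a. K \<le> deg n (gr a) u \<and> deg n (gr a) u \<le> deg n (gr a) v + s
            \<and> deg n (gr a) v \<le> deg n (gr a) u + s \<and> deg n (gr a) v \<le> l} \<le> T (K - 1) * (real (2 * s + 1) * \<beta>)"
proof -
  define Z where "Z = {(x, y). K - 1 \<le> x \<and> x \<le> y + s \<and> y \<le> x + s \<and> y \<le> l}"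
  have Z: "measure_pmf.prob (pair_pmf X X) Z \<le> 0 + (real (2 * s + 1) * \<beta>) * measure_pmf.prob X {K - 1..}"
    unfolding pair_pmf_def
  proof (rule prob_bind_pmf_le)
    fix x
    let ?I = "{y. K - 1 \<le> x \<and> x \<le> y + s \<and> y \<le> x + s \<and> y \<le> l}"
    have "measure_pmf.prob (X \<bind> (\<lambda>y. return_pmf (x, y))) Z = measure_pmf.prob X ?I"
      unfolding map_pmf_def[symmetric] by (simp add: vimage_def Z_def)
    also have "\<dots> \<le> (real (2 * s + 1) * \<beta>) * indicator {K - 1..} x"
    proof (cases "K - 1 \<le> x")
      case True
      have sub: "?I \<subseteq> {x - s..<(x - s) + (2 * s + 1)}" by auto
      have fin: "finite ?I" by (rule finite_subset[OF sub]) simp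
      have "card ?I \<le> card {x - s..<(x - s) + (2 * s + 1)}" by (rule card_mono[OF _ sub]) simp
      hence "real (card ?I) * \<beta> \<le> real (2 * s + 1) * \<beta>" using \<beta>(2) by (intro mult_right_mono) auto
      moreover have "measure_pmf.prob X ?I \<le> real (card ?I) * \<beta>"
        using fin by (intro prob_pmf_finite_le \<beta>(1)) auto
      ultimately show ?thesis using True by simp
    qed simp
    finally show "measure_pmf.prob (X \<bind> (\<lambda>y. return_pmf (x, y))) Z
        \<le> 0 + (real (2 * s + 1) * \<beta>) * indicator {K - 1..} x" by simp
  qed
  have "measure_pmf.prob (er_pmf n p) {a. K \<le> deg n (gr a) u \<and> deg n (gr a) u \<le> deg n (gr a) v + s
            \<and> deg n (gr a) v \<le> deg n (gr a) u + s \<and> deg n (gr a) v \<le> l}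
      = p * measure_pmf.prob (pair_pmf X X) {(x, y). K \<le> Suc x \<and> Suc x \<le> Suc y + s \<and> Suc y \<le> Suc x + s \<and> Suc y \<le> l}
      + (1 - p) * measure_pmf.prob (pair_pmf X X) {(x, y). K \<le> x \<and> x \<le> y + s \<and> y \<le> x + s \<and> y \<le> l}"
    unfolding prob_deg_pair[where Q = "\<lambda>x y. K \<le> x \<and> x \<le> y + s \<and> y \<le> x + s \<and> y \<le> l", OF uv p] X_def ..
  also have "\<dots> \<le> p * measure_pmf.prob (pair_pmf X X) Z + (1 - p) * measure_pmf.prob (pair_pmf X X) Z"
    using p by (intro add_mono mult_left_mono measure_pmf.finite_measure_mono) (auto simp: Z_def)
  also have "\<dots> = measure_pmf.prob (pair_pmf X X) Z" by (simp add: algebra_simps)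
  finally show ?thesis using Z by (simp add: T_def mult.commute)
qed

text \<open>
  The degrees of two vertices share only the edge between them, so the indicators of
  large degree have covariance \<open>p (1 - p) (T (K - 1) - T K)\<^sup>2\<close>, and Chebyshev applies.
\<close>
lemma prob_card_deg_le:
  assumes h: "real h < real n * T K" and m: "m = real n * (p * T (K - 1) + (1 - p) * T K)"
  shows "measure_pmf.prob (er_pmf n p) {a. card {v. v < n \<and> K \<le> deg n (gr a) v} \<le> h}
     \<le> (m + (real n)\<^sup>2 * (p * (pmf X (K - 1))\<^sup>2)) / (m - real h)\<^sup>2"
proof -
  let ?P = "measure_pmf.prob (er_pmf n p)" and ?E = "measure_pmf.expectation (er_pmf n p)"
  define \<pi> where "\<pi> = p * T (K - 1) + (1 - p) * T K"
  define \<rho> where "\<rho> = p * (T (K - 1))\<^sup>2 + (1 - p) * (T K)\<^sup>2"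
  define S where "S = (\<lambda>v. {a. K \<le> deg n (gr a) v})"
  define N where "N = (\<lambda>a. \<Sum>v<n. indicat_real (S v) a)"
  note int = integrable_er_pmf
  have N: "N a = real (card {v. v < n \<and> K \<le> deg n (gr a) v})" for a
    unfolding N_def sum_indicator_eq_card by (simp add: S_def)
  have EN: "?E N = m"
    unfolding N_def m by (subst Bochner_Integration.integral_sum[OF int]) (simp add: S_def prob_deg_tail)
  have "?E (\<lambda>a. (N a)\<^sup>2) = ?E (\<lambda>a. \<Sum>u<n. \<Sum>v<n. indicat_real (S u \<inter> S v) a)"
    by (simp add: N_def power2_eq_square sum_product indicator_inter_arith)
  also have "\<dots> = (\<Sum>u<n. \<Sum>v<n. ?P (S u \<inter> S v))"
    by (subst Bochner_Integration.integral_sum[OF int], subst Bochner_Integration.integral_sum[OF int]) simp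
  also have "\<dots> = (\<Sum>u<n. \<pi> + (real n - 1) * \<rho>)"
  proof (rule sum.cong[OF refl])
    fix u assume u: "u \<in> {..<n}"
    have "(\<Sum>v<n. ?P (S u \<inter> S v)) = ?P (S u \<inter> S u) + (\<Sum>v\<in>{..<n} - {u}. ?P (S u \<inter> S v))"
      using u by (intro sum.remove) auto
    also have "(\<Sum>v\<in>{..<n} - {u}. ?P (S u \<inter> S v)) = (\<Sum>v\<in>{..<n} - {u}. \<rho>)"
      using prob_deg_pair_tail[of u _ K] u by (intro sum.cong) (auto simp: S_def \<rho>_def Collect_conj_eq)
    finally show "(\<Sum>v<n. ?P (S u \<inter> S v)) = \<pi> + (real n - 1) * \<rho>"
      using u n by (simp add: S_def prob_deg_tail \<pi>_def of_nat_diff)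
  qed
  finally have EN2: "?E (\<lambda>a. (N a)\<^sup>2) = m + (real n)\<^sup>2 * \<rho> - real n * \<rho>"
    by (simp add: m \<pi>_def algebra_simps power2_eq_square)
  have "?E (\<lambda>a. (N a - m)\<^sup>2) = ?E (\<lambda>a. (N a)\<^sup>2 - 2 * m * N a + m\<^sup>2)"
    by (simp add: power2_diff algebra_simps)
  also have "\<dots> = ?E (\<lambda>a. (N a)\<^sup>2) - 2 * m * ?E N + m\<^sup>2"
    by (simp add: int)
  also have "\<dots> = m + (real n)\<^sup>2 * (\<rho> - \<pi>\<^sup>2) - real n * \<rho>"
    unfolding EN2 EN unfolding m \<pi>_def[symmetric] by (simp add: power2_eq_square algebra_simps)
  also have "\<rho> - \<pi>\<^sup>2 = p * ((1 - p) * (T (K - 1) - T K)\<^sup>2)"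
    by (simp add: \<rho>_def \<pi>_def power2_eq_square algebra_simps)
  also have "m + (real n)\<^sup>2 * (p * ((1 - p) * (T (K - 1) - T K)\<^sup>2)) - real n * \<rho>
       \<le> m + (real n)\<^sup>2 * (p * (1 * (pmf X (K - 1))\<^sup>2)) - 0"
    using p binomial_tail_pred_le[of K] binomial_tail_antimono[of "K - 1" K] 
    by (intro diff_mono add_left_mono mult_left_mono mult_mono power_mono) (auto simp: \<rho>_def)
  finally have var: "?E (\<lambda>a. (N a - m)\<^sup>2) \<le> m + (real n)\<^sup>2 * (p * (pmf X (K - 1))\<^sup>2)" by simp
  have hm: "real h < m"
  proof -
    have "T K \<le> \<pi>" using prob_deg_tail_bounds(1)[of 0 K] prob_deg_tail[of 0 K] n by (simp add: \<pi>_def)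
    hence "real n * T K \<le> m" unfolding m \<pi>_def[symmetric] by (intro mult_left_mono) auto
    thus ?thesis using h by simp
  qed
  have "?P {a. card {v. v < n \<and> K \<le> deg n (gr a) v} \<le> h} \<le> ?P {a \<in> space (er_pmf n p). (m - real h)\<^sup>2 \<le> (N a - m)\<^sup>2}"
  proof (rule measure_pmf.finite_measure_mono)
    show "{a. card {v. v < n \<and> K \<le> deg n (gr a) v} \<le> h} \<subseteq> {a \<in> space (er_pmf n p). (m - real h)\<^sup>2 \<le> (N a - m)\<^sup>2}"
    proof clarify
      fix a assume "card {v. v < n \<and> K \<le> deg n (gr a) v} \<le> h"
      hence "N a \<le> real h" by (simp add: N)
      hence "\<bar>m - real h\<bar> \<le> \<bar>N a - m\<bar>" using hm by linarith
      thus "a \<in> space (er_pmf n p) \<and> (m - real h)\<^sup>2 \<le> (N a - m)\<^sup>2" by (simp add: abs_le_square_iff)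
    qed
  qed auto
  also have "\<dots> \<le> ?E (\<lambda>a. (N a - m)\<^sup>2) / (m - real h)\<^sup>2"
    using hm by (intro integral_Markov_inequality_measure[where A = "{}"] int) auto
  also have "\<dots> \<le> (m + (real n)\<^sup>2 * (p * (pmf X (K - 1))\<^sup>2)) / (m - real h)\<^sup>2"
    by (intro divide_right_mono var) auto
  finally show ?thesis .
qed

lemma prob_card_deg_ge:
  assumes "0 < x"
  shows "measure_pmf.prob (er_pmf n p) {a. x \<le> real (card {v. v < n \<and> K \<le> deg n (gr a) v})}
     \<le> real n * T (K - 1) / x"
proof -
  let ?P = "measure_pmf.prob (er_pmf n p)" and ?E = "measure_pmf.expectation (er_pmf n p)"
  define S where "S = (\<lambda>v. {a. K \<le> deg n (gr a) v})"
  define N where "N = (\<lambda>a. \<Sum>v<n. indicat_real (S v) a)"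
  note int = integrable_er_pmf
  have N: "N a = real (card {v. v < n \<and> K \<le> deg n (gr a) v})" for a
    unfolding N_def sum_indicator_eq_card by (simp add: S_def)
  have "?P {a \<in> space (er_pmf n p). x \<le> N a} \<le> ?E N / x"
    using assms by (intro integral_Markov_inequality_measure[where A = "{}"] int) (auto simp: N_def intro!: sum_nonneg)
  also have "?E N = (\<Sum>v<n. ?P (S v))"
    unfolding N_def by (subst Bochner_Integration.integral_sum[OF int]) simp
  also have "\<dots> \<le> (\<Sum>v<n. T (K - 1))"
    unfolding S_def by (intro sum_mono prob_deg_tail_bounds(2)) simp
  finally show ?thesis using assms by (simp add: N divide_right_mono)
qed

end

text \<open>
  \<open>K\<close> is a level above which about \<open>4 h\<close> vertices are expected, \<open>M\<close> is the width of a window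
  below \<open>K\<close> over which this number grows only by a constant factor, \<open>l\<close> bounds all degrees, and
  \<open>s\<close> is the separation of the degrees above \<open>K\<close>.
\<close>
definition well_spread :: "nat \<Rightarrow> nat \<Rightarrow> nat \<Rightarrow> nat \<Rightarrow> nat \<Rightarrow> nat \<Rightarrow> (nat \<Rightarrow> nat) \<Rightarrow> bool" where
  "well_spread n h M s l K d \<longleftrightarrow>
     (\<forall>v<n. d v \<le> l) \<and>
     h < card {v. v < n \<and> K \<le> d v} \<and>
     card {v. v < n \<and> K + 2 - M \<le> d v} < h\<^sup>2 \<and>
     (\<forall>u<n. \<forall>v<n. u \<noteq> v \<longrightarrow> K \<le> d u \<longrightarrow> d v \<le> d u + s \<longrightarrow> d v + s < d u)"

section \<open>The first graph is well spread with high probability\<close>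

lemma exp_neg_4_ln:
  assumes "1 \<le> n"
  shows "exp (- 4 * ln (real n)) = 1 / real n ^ 4"
proof -
  have "exp (- 4 * ln (real n)) = inverse (exp (4 * ln (real n)))" by (simp flip: exp_minus)
  also have "exp (4 * ln (real n)) = exp (ln (real n)) ^ 4" by (simp flip: exp_of_nat_mult)
  finally show ?thesis using assms by (simp add: divide_inverse)
qed

lemma sum_star_centred:
  assumes "v < n"
  shows "(\<Sum>e\<in>star n v. of_bool (a e) - c) = real (deg n (gr a) v) - (real n - 1) * c"
  using assms
  by (simp add: sum_subtractf card_star deg_gr of_nat_diff finite_star Collect_conj_eq flip: Int_def)

text \<open>Bernstein with \<open>c = ln n\<close> and \<open>V = n * p\<close>: this deviation
  satisfies the Gaussian condition with equality, and \<open>4 * ln n \<le> n * p\<close> is what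
  the Poisson condition then requires.\<close>

lemma prob_deg_deviation:
  assumes n: "2 \<le> n" and p: "0 \<le> p" "p \<le> 1" and ln: "4 * ln (real n) \<le> real n * p" and u: "u < n"
  shows "measure_pmf.prob (er_pmf n p)
     {a. 4 * sqrt (real n * p * ln (real n)) \<le> \<bar>real (deg n (gr a) u) - (real n - 1) * p\<bar>} \<le> 2 / real n ^ 4"
proof -
  let ?l = "ln (real n)"
  have l: "0 < ?l" using n by simp
  have "2 * ?l \<le> sqrt (real n * p * ?l)"
  proof (rule real_le_rsqrt)
    have "4 * ?l * ?l \<le> real n * p * ?l" using ln l by (intro mult_right_mono) auto
    thus "(2 * ?l)\<^sup>2 \<le> real n * p * ?l" by (simp add: power2_eq_square)
  qed
  moreover have "(4 * sqrt (real n * p * ?l))\<^sup>2 = 16 * (real n * p) * ?l"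
    using p l by (simp add: power_mult_distrib)
  moreover have "(\<Sum>e\<in>star n u. p) \<le> real n * p"
    using u p by (auto simp: card_star intro!: mult_right_mono)
  ultimately have "measure_pmf.prob (er_pmf n p)
     {a. 4 * sqrt (real n * p * ?l) \<le> \<bar>\<Sum>e\<in>star n u. of_bool (a e) - p\<bar>} \<le> 2 * exp (- 4 * ?l)"
    using u p l
    by (intro Pi_bernoulli_chernoff[where w = "\<lambda>_. p" and V = "real n * p"] finite_edges star_subset_edges) auto
  thus ?thesis using exp_neg_4_ln[of n] n u by (simp add: sum_star_centred)
qed

text \<open>\<open>A1\<close> to \<open>A4\<close> treat the four ways to fail. The dominant one is
  \<open>A4\<close>: each of \<open>n^2\<close> ordered pairs is close with probability at most
  \<open>5 * \<tau> * (2 * s + 1) * (4 * \<tau> / M)\<close>, and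
  \<open>n * \<tau> = 4 * h\<close>.\<close>

lemma er_well_spread:
  fixes n h M s l :: nat and p \<eta> :: real
  assumes h: "1 \<le> h" "4 * h \<le> n" and p: "0 \<le> p" "p \<le> 1/2" and ln: "4 * ln (real n) \<le> real n * p"
    and l: "l = nat \<lfloor>real n * p + 4 * sqrt (real n * p * ln (real n))\<rfloor>"
    and \<eta>: "0 \<le> \<eta>" "\<eta> \<le> 1" "real M * \<eta> \<le> 1/2" and M: "3 \<le> M" "s + 2 \<le> M"
    and lM: "real (l + 1 + M) \<le> real (n - 2) * p * (1 + \<eta> / 2)"
  shows "\<exists>K. measure_pmf.prob (er_pmf n p) {a. \<not> well_spread n h M s l K (deg n (gr a))}
              \<le> 23 / real h + 352 * (real h)\<^sup>2 * real (2 * s + 1) / real M"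
proof -
  let ?P = "measure_pmf.prob (er_pmf n p)"
  let ?l = "ln (real n)"
  define X where "X = binomial_pmf (n - 2) p"
  define T where "T = (\<lambda>k. measure_pmf.prob X {k..})"
  have n: "2 \<le> n" "0 < n" using h by auto
  have p1: "p \<le> 1" using p by simp
  have T_app: "measure_pmf.prob X {k..} = T k" for k by (simp add: T_def)
  note tools = prob_deg_tail_bounds[OF n(1) p(1) p1, folded X_def, unfolded T_app]
  have sq: "0 \<le> sqrt (real n * p * ?l)" using n p by simp
  have big: "?P {a. l < deg n (gr a) v} \<le> 2 / real n ^ 4" if "v < n" for v
  proof -
    have "?P {a. l < deg n (gr a) v} \<le> ?P {a. 4 * sqrt (real n * p * ?l) \<le> \<bar>real (deg n (gr a) v) - (real n - 1) * p\<bar>}"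
    proof (rule prob_pmf_mono)
      fix a assume "l < deg n (gr a) v"
      hence "\<lfloor>real n * p + 4 * sqrt (real n * p * ?l)\<rfloor> < int (deg n (gr a) v)"
        unfolding l using sq p by (simp add: nat_less_iff)
      hence "real n * p + 4 * sqrt (real n * p * ?l) < real (deg n (gr a) v)" by linarith
      moreover have "(real n - 1) * p \<le> real n * p" using p by (simp add: algebra_simps)
      ultimately show "4 * sqrt (real n * p * ?l) \<le> \<bar>real (deg n (gr a) v) - (real n - 1) * p\<bar>" by linarith
    qed
    also have "\<dots> \<le> 2 / real n ^ 4" by (rule prob_deg_deviation[OF n(1) p(1) p1 ln that])
    finally show ?thesis .
  qed
  have n4: "real n * (2 / real n ^ 4) \<le> 2 / real n"
  proof -
    have "real n ^ 1 \<le> real n ^ 3" using n by (intro power_increasing) auto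
    thus ?thesis using n by (simp add: power4_eq_xxxx power3_eq_cube field_simps)
  qed
  \<comment> \<open>The factor 4 puts the expected number of vertices above \<open>K\<close> well
    beyond \<open>h\<close>, which leaves room for the second moment bound.\<close>
  define \<tau> where "\<tau> = 4 * real h / real n"
  have h0: "real h > 0" "real h \<ge> 1" using h by auto
  \<comment> \<open>The degree bound is turned back into a binomial tail bound. It guarantees that
    the tail crosses the value \<open>\<tau>\<close>, and that it does so no later than at
    \<open>l\<close>.\<close>
  have Tl: "T (Suc l) < \<tau>"
  proof -
    have "real n * T (Suc l) \<le> real n * ?P {a. Suc l \<le> deg n (gr a) 0}"
      using n tools(1)[of 0 "Suc l"] by (intro mult_left_mono) auto
    also have "\<dots> \<le> real n * (2 / real n ^ 4)"
      using big[of 0] n by (intro mult_left_mono) (auto simp: Suc_le_eq)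
    also have "\<dots> \<le> 2 / real n" by (rule n4)
    also have "\<dots> \<le> 1" using n by simp
    also have "\<dots> < 4 * real h" using h0 by simp
    finally show ?thesis using n by (simp add: \<tau>_def field_simps)
  qed
  have T_mono: "T j \<le> T i" if "i \<le> j" for i j
    unfolding T_def using that by (intro measure_pmf.finite_measure_mono) auto
  have "\<tau> \<le> T 0" using h n by (simp add: T_def \<tau>_def field_simps)
  obtain K where K: "\<tau> \<le> T K" "T (Suc K) < \<tau>"
  proof -
    have "\<exists>K. \<tau> \<le> T K \<and> \<not> \<tau> \<le> T (Suc K)"
    proof (rule ccontr)
      assume "\<not> ?thesis"
      hence "\<tau> \<le> T k" for k using \<open>\<tau> \<le> T 0\<close> by (induction k) auto
      from this[of "Suc l"] show False using Tl by simp
    qed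
    thus ?thesis using that by (auto simp: not_le)
  qed
  have Kl: "K \<le> l"
  proof (rule ccontr)
    assume "\<not> K \<le> l"
    hence "T K \<le> T (Suc l)" by (intro T_mono) simp
    thus False using K Tl by simp
  qed
  have M0: "0 < M" using M by simp
  have \<tau>': "measure_pmf.prob X {Suc K..} \<le> \<tau>" using K by (simp add: T_def)
  note near = pmf_binomial_near_le[OF p \<eta> M0 Kl lM \<tau>'[unfolded X_def], folded X_def]
  note near' = prob_binomial_near_le[OF p \<eta> M0 Kl lM \<tau>'[unfolded X_def], folded X_def]
  have \<tau>0: "0 \<le> \<tau>" by (simp add: \<tau>_def)
  have TW: "T (K + 2 - M - 1) \<le> 5 * \<tau>"
  proof -
    \<comment> \<open>The offset 2 of the window absorbs two shifts: the tail bound starts at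
      \<open>Suc K\<close>, and an edge indicator lowers the binomial threshold by one more.\<close>
    have "{K + 2 - M - 1..} \<subseteq> {k. Suc K \<le> k + M}" by auto
    hence "T (K + 2 - M - 1) \<le> measure_pmf.prob X {k. Suc K \<le> k + M}"
      unfolding T_def by (intro measure_pmf.finite_measure_mono) auto
    thus ?thesis using near' by linarith
  qed
  have A1: "?P {a. \<exists>v\<in>{..<n}. l < deg n (gr a) v} \<le> 2 / real n"
    using prob_pmf_ex_le[of "{..<n}" "er_pmf n p" "\<lambda>v a. l < deg n (gr a) v" "2 / real n ^ 4"] big n4
    by simp
  have A2: "?P {a. card {v. v < n \<and> K \<le> deg n (gr a) v} \<le> h} \<le> 1 / real h + 32 / real M"
  proof -
    define m where "m = real n * (p * T (K - 1) + (1 - p) * T K)"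
    define b where "b = pmf X (K - 1)"
    have "real n * T K \<ge> real n * \<tau>" using K by (intro mult_left_mono) auto
    hence nT: "4 * real h \<le> real n * T K" using n by (simp add: \<tau>_def)
    have "T K = p * T K + (1 - p) * T K" by (simp add: algebra_simps)
    also have "\<dots> \<le> p * T (K - 1) + (1 - p) * T K" using p T_mono[of "K - 1" K] by (intro add_mono mult_left_mono) auto
    finally have "real n * T K \<le> m" unfolding m_def by (intro mult_left_mono) auto
    hence m: "4 * real h \<le> m" using nT by linarith
    have "b \<le> 4 * \<tau> / real M" unfolding b_def using Kl M by (intro near) auto
    hence "b\<^sup>2 \<le> (4 * \<tau> / real M)\<^sup>2" by (intro power_mono) (auto simp: b_def)
    also have "\<dots> = 256 * (real h)\<^sup>2 / (real M)\<^sup>2 / (real n)\<^sup>2"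
      by (simp add: \<tau>_def power_divide power_mult_distrib)
    finally have "(real n)\<^sup>2 * (p * b\<^sup>2) \<le> (real n)\<^sup>2 * (1 * (256 * (real h)\<^sup>2 / (real M)\<^sup>2 / (real n)\<^sup>2))"
      using p1 p by (intro mult_left_mono mult_mono) auto
    also have "\<dots> = 256 * (real h)\<^sup>2 / (real M)\<^sup>2" using n by simp
    finally have b2: "(real n)\<^sup>2 * (p * b\<^sup>2) \<le> 256 * (real h)\<^sup>2 / (real M)\<^sup>2" .
    have m0: "0 < m" using m h0 by linarith
    \<comment> \<open>As \<open>m \<ge> 4 * h\<close>, falling to \<open>h\<close> is a deviation of
      at least three quarters of the mean, and 9/16 exceeds 1/2.\<close>
    have "m\<^sup>2 / 2 \<le> (3 / 4 * m)\<^sup>2" by (simp add: power_mult_distrib power2_eq_square)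
    also have "\<dots> \<le> (m - real h)\<^sup>2" using m m0 by (intro power_mono) auto
    finally have mh: "m\<^sup>2 / 2 \<le> (m - real h)\<^sup>2" .
    have frac: "(m + A) / (m\<^sup>2 / 2) = 2 / m + 2 * A / m\<^sup>2" for A
      using m0 by (simp add: field_simps power2_eq_square)
    have "?P {a. card {v. v < n \<and> K \<le> deg n (gr a) v} \<le> h} \<le> (m + (real n)\<^sup>2 * (p * b\<^sup>2)) / (m - real h)\<^sup>2"
      unfolding b_def X_def
      by (rule prob_card_deg_le[OF n(1) p(1) p1]) (use nT h0 in \<open>auto simp: m_def T_def X_def\<close>)
    also have "\<dots> \<le> (m + 256 * (real h)\<^sup>2 / (real M)\<^sup>2) / (m\<^sup>2 / 2)"
      using b2 mh m0 p by (intro frac_le) auto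
    also have "\<dots> = 2 / m + 512 * (real h)\<^sup>2 / (real M)\<^sup>2 / m\<^sup>2" unfolding frac by simp
    also have "\<dots> \<le> 2 / (4 * real h) + 512 * (real h)\<^sup>2 / (real M)\<^sup>2 / (4 * real h)\<^sup>2"
      using m h0 m0 by (intro add_mono divide_left_mono power_mono mult_pos_pos) auto
    also have "\<dots> = 1 / (2 * real h) + 32 / (real M)\<^sup>2"
      using h0 by (simp add: power_mult_distrib)
    also have "\<dots> \<le> 1 / real h + 32 / real M"
    proof (intro add_mono divide_left_mono)
      have "real M * 1 \<le> real M * real M" using M by (intro mult_left_mono) auto
      thus "real M \<le> (real M)\<^sup>2" by (simp add: power2_eq_square)
    qed (use h0 M in auto)
    finally show ?thesis .
  qed
  have A3: "?P {a. (real h)\<^sup>2 \<le> real (card {v. v < n \<and> K + 2 - M \<le> deg n (gr a) v})} \<le> 20 / real h"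
  proof -
    have "?P {a. (real h)\<^sup>2 \<le> real (card {v. v < n \<and> K + 2 - M \<le> deg n (gr a) v})}
        \<le> real n * T (K + 2 - M - 1) / (real h)\<^sup>2"
      unfolding T_def X_def using h0 by (intro prob_card_deg_ge n p p1) auto
    also have "\<dots> \<le> real n * (5 * \<tau>) / (real h)\<^sup>2" using TW by (intro divide_right_mono mult_left_mono) auto
    also have "\<dots> = 20 / real h" using n h0 by (simp add: \<tau>_def power2_eq_square)
    finally show ?thesis .
  qed
  define close where "close = (\<lambda>(u, v) a. u \<noteq> v \<and> K \<le> deg n (gr a) u \<and> deg n (gr a) u \<le> deg n (gr a) v + s
            \<and> deg n (gr a) v \<le> deg n (gr a) u + s \<and> deg n (gr a) v \<le> l)"
  have A4: "?P {a. \<exists>uv\<in>{..<n} \<times> {..<n}. close uv a} \<le> 320 * (real h)\<^sup>2 * real (2 * s + 1) / real M"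
  proof -
    have TK: "T (K - 1) \<le> 5 * \<tau>"
      using TW T_mono[of "K + 2 - M - 1" "K - 1"] M by linarith
    have "?P {a. \<exists>uv\<in>{..<n} \<times> {..<n}. close uv a}
       \<le> real (card ({..<n} \<times> {..<n})) * (5 * \<tau> * (real (2 * s + 1) * (4 * \<tau> / real M)))"
    proof (rule prob_pmf_ex_le)
      fix uv assume uv: "uv \<in> {..<n} \<times> {..<n}"
      obtain u v where [simp]: "uv = (u, v)" by (cases uv)
      show "?P {a. close uv a} \<le> 5 * \<tau> * (real (2 * s + 1) * (4 * \<tau> / real M))"
      proof (cases "u = v")
        case True
        thus ?thesis using \<tau>0 by (simp add: close_def)
      next
        case False
        \<comment> \<open>A partner within \<open>s\<close> of a degree above \<open>K\<close> has
          count at least \<open>K - s - 1\<close>; \<open>s + 2 \<le> M\<close> places it in the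
          window where \<open>near\<close> bounds the point masses.\<close>
        have "?P {a. close uv a} \<le> T (K - 1) * (real (2 * s + 1) * (4 * \<tau> / real M))"
          using prob_deg_close[OF n(1) p(1) p1, of u v K s l "4 * \<tau> / real M"] uv False near M \<tau>0
          by (simp add: close_def T_def X_def)
        also have "\<dots> \<le> 5 * \<tau> * (real (2 * s + 1) * (4 * \<tau> / real M))"
          using TK \<tau>0 by (intro mult_right_mono) auto
        finally show ?thesis .
      qed
    qed simp
    also have "\<dots> = 320 * (real h)\<^sup>2 * real (2 * s + 1) / real M"
    proof -
      have "real n * real n * (5 * (4 * H / real n) * (S * (4 * (4 * H / real n) / m))) = 320 * (H * H) * S / m" for H S m :: real
        using n by (simp add: field_simps)
      thus ?thesis by (simp add: \<tau>_def card_cartesian_product power2_eq_square)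
    qed
    finally show ?thesis .
  qed
  have "?P {a. \<not> well_spread n h M s l K (deg n (gr a))} \<le> 
     ?P {a. (\<exists>v\<in>{..<n}. l < deg n (gr a) v) \<or> card {v. v < n \<and> K \<le> deg n (gr a) v} \<le> h
       \<or> (real h)\<^sup>2 \<le> real (card {v. v < n \<and> K + 2 - M \<le> deg n (gr a) v})
       \<or> (\<exists>uv\<in>{..<n} \<times> {..<n}. close uv a)}"
  proof (rule prob_pmf_mono)
    fix a
    have c: "(real h)\<^sup>2 \<le> real (card {v. v < n \<and> K + 2 - M \<le> deg n (gr a) v}) \<longleftrightarrow>
        h\<^sup>2 \<le> card {v. v < n \<and> K + 2 - M \<le> deg n (gr a) v}"
      by (simp only: of_nat_power[symmetric] of_nat_le_iff)
    let ?d = "deg n (gr a)"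
    assume nw: "\<not> well_spread n h M s l K ?d"
    show "(\<exists>v\<in>{..<n}. l < ?d v) \<or> card {v. v < n \<and> K \<le> ?d v} \<le> h
       \<or> (real h)\<^sup>2 \<le> real (card {v. v < n \<and> K + 2 - M \<le> ?d v})
       \<or> (\<exists>uv\<in>{..<n} \<times> {..<n}. close uv a)"
    proof (rule ccontr)
      assume "\<not> ?thesis"
      hence *: "\<forall>v<n. ?d v \<le> l" "h < card {v. v < n \<and> K \<le> ?d v}"
        "card {v. v < n \<and> K + 2 - M \<le> ?d v} < h\<^sup>2"
        and nc: "\<And>u v. u < n \<Longrightarrow> v < n \<Longrightarrow> \<not> close (u, v) a"
        unfolding c by (force simp: not_less not_le)+
      have "?d v + s < ?d u" if "u < n" "v < n" "u \<noteq> v" "K \<le> ?d u" "?d v \<le> ?d u + s" for u v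
        using nc[OF that(1,2)] that *(1) unfolding close_def by auto
      hence "well_spread n h M s l K ?d" unfolding well_spread_def using * by blast
      thus False using nw by blast
    qed
  qed
  also have "\<dots> \<le> 2 / real n + ((1 / real h + 32 / real M) + (20 / real h + 320 * (real h)\<^sup>2 * real (2 * s + 1) / real M))"
    by (intro order_trans[OF prob_pmf_disj_le] add_mono A1 A2 A3 A4)
  also have "\<dots> \<le> 23 / real h + 352 * (real h)\<^sup>2 * real (2 * s + 1) / real M"
  proof -
    define Q where "Q = (real h)\<^sup>2 * real (2 * s + 1) / real M"
    have "2 / real n \<le> 2 / real h" using h by (intro divide_left_mono) auto
    moreover have "1 * 1 \<le> (real h)\<^sup>2 * real (2 * s + 1)" using h0 by (intro mult_mono) auto
    hence "1 / real M \<le> Q" unfolding Q_def by (intro divide_right_mono) auto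
    moreover have "23 / real h = 2 / real h + (1 / real h + 20 / real h)" by (simp flip: add_divide_distrib)
    moreover have "320 * (real h)\<^sup>2 * real (2 * s + 1) / real M = 320 * Q"
       "352 * (real h)\<^sup>2 * real (2 * s + 1) / real M = 352 * Q"
       "32 / real M = 32 * (1 / real M)" by (simp_all add: Q_def)
    ultimately show ?thesis by linarith
  qed
  finally show ?thesis by blast
qed

section \<open>Transfer to the second graph\<close>

lemma leads_cong:
  assumes "\<And>v. v < n \<Longrightarrow> f v = g v"
  shows "leads f n c ws \<longleftrightarrow> leads g n c ws"
proof -
  have "leads g n c ws" if "leads f n c ws" "\<And>v. v < n \<Longrightarrow> f v = g v" for f g :: "nat \<Rightarrow> nat"
    using that by (auto simp: leads_def subset_iff) 
  from this[of f g] this[of g f] assms show ?thesis by metis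
qed

text \<open>Conditional means are affine in \<open>d\<close> with slope
  \<open>1 - (\<alpha> + \<beta>) \<ge> 1/2\<close>, so at least half of each gap survives. Inside
  the window the gap exceeds \<open>s\<close> and the two deviations total less than
  \<open>s / 4\<close>; below it the gap is at least \<open>M - 1\<close> and they total less than
  \<open>M / 4\<close>. The bounds \<open>s \<ge> 9\<close> and \<open>M \<ge> 11\<close> leave more
  than 2 in each case.\<close>

lemma leads_perturbed:
  fixes d d' :: "nat \<Rightarrow> nat" and \<alpha> \<beta> :: real
  assumes leads: "leads d n s ws" and K: "\<And>u. u \<in> set ws \<Longrightarrow> K \<le> d u"
    and s: "9 \<le> s" "s + 2 \<le> M" and \<alpha>\<beta>: "0 \<le> \<alpha>" "0 \<le> \<beta>" "\<alpha> + \<beta> \<le> 1/2"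
    and dev: "\<And>v. v < n \<Longrightarrow> \<bar>real (d' v) - (real (d v) * (1 - \<alpha>) + (real n - 1 - real (d v)) * \<beta>)\<bar>
         < (if K + 2 - M \<le> d v then real s / 8 else real M / 8)"
  shows "leads d' n 2 ws"
  unfolding leads_def
proof (intro conjI allI impI)
  show "distinct ws" "set ws \<subseteq> {..<n}" using leads by (auto simp: leads_def)
  fix i v assume i: "i < length ws" and v: "v < n" "v \<notin> set (take (Suc i) ws)"
  define u where "u = ws ! i"
  have u: "u \<in> set ws" using i by (simp add: u_def)
  hence un: "u < n" using leads by (auto simp: leads_def)
  have gap: "d v + s < d u" using leads i v by (auto simp: leads_def u_def)
  define mean where "mean = (\<lambda>v. real (d v) * (1 - \<alpha>) + (real n - 1 - real (d v)) * \<beta>)"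
  define g where "g = real (d u) - real (d v)"
  have g: "real s + 1 \<le> g" using gap by (simp add: g_def)
  have "mean u - mean v = g * (1 - (\<alpha> + \<beta>))" by (simp add: mean_def g_def algebra_simps)
  also have "\<dots> \<ge> g * (1 / 2)" using g \<alpha>\<beta> by (intro mult_left_mono) auto
  finally have mean: "g / 2 \<le> mean u - mean v" by simp
  have du: "\<bar>real (d' u) - mean u\<bar> < real s / 8"
    using dev[OF un] K[OF u] s by (simp add: mean_def split: if_splits)
  have "real (d' v) + 2 < real (d' u)"
  proof (cases "K + 2 - M \<le> d v")
    case True
    hence "\<bar>real (d' v) - mean v\<bar> < real s / 8" using dev[OF v(1)] by (simp add: mean_def)
    thus ?thesis using du mean g s(1) by (simp add: abs_if split: if_splits)
  next
    case False
    hence "\<bar>real (d' v) - mean v\<bar> < real M / 8" using dev[OF v(1)] by (simp add: mean_def)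
    moreover have "d v + M \<le> d u + 1" using False K[OF u] by simp
    hence "real M - 1 \<le> g" by (simp add: g_def)
    moreover have "real s \<le> real M" "real M \<ge> 11" using s by auto
    ultimately show ?thesis using du mean by (simp add: abs_if split: if_splits)
  qed
  thus "d' v + 2 < d' (ws ! i)" by (simp add: u_def)
qed

text \<open>
  Given the first graph, the degree of \<open>v\<close> in the second one is a sum of independent indicators.
  Deviations of order \<open>s\<close> matter only for the at most \<open>h\<^sup>2\<close> vertices in the window, so the
  union bound costs \<open>ln h\<close>; the union over all vertices costs \<open>ln n\<close>, but the vertices below the
  window are allowed deviations of order \<open>M\<close>.
\<close>
lemma prob_second_graph:
  fixes a :: "nat \<times> nat \<Rightarrow> bool" and \<alpha> \<beta> :: real and n h M s l K :: nat
  assumes spread: "well_spread n h M s l K (deg n (gr a))"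
    and h: "2 \<le> h" "h \<le> n" and s: "9 \<le> s" "s + 2 \<le> M"
    and \<alpha>\<beta>: "0 \<le> \<alpha>" "0 \<le> \<beta>" "\<alpha> + \<beta> \<le> 1/2"
    and V: "\<alpha> * real l + \<beta> * real n \<le> V"
    and sh: "64 * ln (real h) \<le> real s" "1024 * V * ln (real h) \<le> (real s)\<^sup>2"
    and Mn: "64 * ln (real n) \<le> real M" "1024 * V * ln (real n) \<le> (real M)\<^sup>2"
  shows "measure_pmf.prob (Pi_pmf (edges n) False (\<lambda>e. bernoulli_pmf (if a e then 1 - \<alpha> else \<beta>)))
    {b. \<not> (\<exists>ws. length ws = h \<and> leads (deg n (gr a)) n 2 ws \<and> leads (deg n (gr b)) n 2 ws)} \<le> 4 / real h"
proof -
  let ?r = "\<lambda>e. if a e then 1 - \<alpha> else \<beta>"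
  let ?P = "measure_pmf.prob (Pi_pmf (edges n) False (\<lambda>e. bernoulli_pmf (?r e)))"
  let ?d = "deg n (gr a)"
  let ?mean = "\<lambda>v. real (?d v) * (1 - \<alpha>) + (real n - 1 - real (?d v)) * \<beta>"
  define W where "W = {v. v < n \<and> K + 2 - M \<le> ?d v}"
  have dl: "?d v \<le> l" if "v < n" for v using spread that by (simp add: well_spread_def)
  have split_sum: "(\<Sum>e\<in>star n v. if a e then x else y) = real (?d v) * x + (real n - 1 - real (?d v)) * y"
    if "v < n" for v and x y :: real
  proof -
    have "(\<Sum>e\<in>star n v. if a e then x else y) = (\<Sum>e\<in>star n v. y + (x - y) * of_bool (a e))"
      by (intro sum.cong) auto
    also have "\<dots> = (real n - 1) * y + (x - y) * real (?d v)"
      using that by (simp add: sum.distrib card_star of_nat_diff deg_gr finite_star Collect_conj_eq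
          flip: sum_distrib_left Int_def)
    finally show ?thesis by (simp add: algebra_simps)
  qed
  have chern: "?P {b. x \<le> \<bar>real (deg n (gr b) v) - ?mean v\<bar>} \<le> 2 / real m ^ 4"
    if v: "v < n" and m: "2 \<le> m" and x: "8 * ln (real m) \<le> x" "16 * V * ln (real m) \<le> x\<^sup>2" for v m x
  proof -
    have "(\<Sum>e\<in>star n v. if a e then \<alpha> else \<beta>) \<le> V"
    proof -
      have "real (?d v) * \<alpha> + (real n - 1 - real (?d v)) * \<beta> \<le> real l * \<alpha> + real n * \<beta>"
        using dl[OF v] \<alpha>\<beta> by (intro add_mono mult_right_mono) auto
      thus ?thesis using V by (simp add: split_sum[OF v] mult.commute)
    qed
    moreover have "0 < ln (real m)" using m by simp
    ultimately have "?P {b. x \<le> \<bar>\<Sum>e\<in>star n v. of_bool (b e) - ?r e\<bar>} \<le> 2 * exp (- 4 * ln (real m))"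
      using x \<alpha>\<beta> v
      by (intro Pi_bernoulli_chernoff[where w = "\<lambda>e. if a e then \<alpha> else \<beta>" and V = V]
            finite_edges star_subset_edges) auto
    moreover have "(\<Sum>e\<in>star n v. of_bool (b e) - ?r e) = real (deg n (gr b) v) - ?mean v" for b
      using v by (simp add: sum_subtractf split_sum) (simp add: deg_gr finite_star Collect_conj_eq flip: Int_def)
    ultimately show ?thesis using exp_neg_4_ln[of m] m by simp
  qed
  \<comment> \<open>Deviations \<open>s / 8\<close> and \<open>M / 8\<close> in the Bernstein
    conditions give the constants 64 = 8 * 8 and 1024 = 16 * 64 of the hypotheses.\<close>
  have P1: "?P {b. \<exists>v\<in>W. real s / 8 \<le> \<bar>real (deg n (gr b) v) - ?mean v\<bar>} \<le> real (card W) * (2 / real h ^ 4)"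
    using sh h by (intro prob_pmf_ex_le chern) (auto simp: W_def power_divide)
  have P2: "?P {b. \<exists>v\<in>{..<n}. real M / 8 \<le> \<bar>real (deg n (gr b) v) - ?mean v\<bar>} \<le> real (card {..<n}) * (2 / real n ^ 4)"
    using Mn h by (intro prob_pmf_ex_le chern) (auto simp: power_divide)
  have cW: "card W \<le> h\<^sup>2" using spread by (simp add: well_spread_def W_def)
  have "?P {b. \<not> (\<exists>ws. length ws = h \<and> leads ?d n 2 ws \<and> leads (deg n (gr b)) n 2 ws)}
     \<le> ?P {b. (\<exists>v\<in>W. real s / 8 \<le> \<bar>real (deg n (gr b) v) - ?mean v\<bar>) \<or>
             (\<exists>v\<in>{..<n}. real M / 8 \<le> \<bar>real (deg n (gr b) v) - ?mean v\<bar>)}"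
  proof (rule prob_pmf_mono, rule ccontr)
    fix b
    assume no: "\<not> (\<exists>ws. length ws = h \<and> leads ?d n 2 ws \<and> leads (deg n (gr b)) n 2 ws)"
    assume "\<not> ((\<exists>v\<in>W. real s / 8 \<le> \<bar>real (deg n (gr b) v) - ?mean v\<bar>) \<or>
             (\<exists>v\<in>{..<n}. real M / 8 \<le> \<bar>real (deg n (gr b) v) - ?mean v\<bar>))"
    hence dev: "\<bar>real (deg n (gr b) v) - ?mean v\<bar> < (if K + 2 - M \<le> ?d v then real s / 8 else real M / 8)"
      if "v < n" for v using that by (auto simp: W_def not_le)
    have "\<exists>ws. length ws = h \<and> leads ?d n s ws \<and> (\<forall>u\<in>set ws. K \<le> ?d u)"
      using spread by (intro leads_exists) (auto simp: well_spread_def)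
    then obtain ws where ws: "length ws = h" "leads ?d n s ws" "\<And>u. u \<in> set ws \<Longrightarrow> K \<le> ?d u" by blast
    have "leads ?d n 2 ws" using ws(2) s by (fastforce simp: leads_def)
    moreover have "leads (deg n (gr b)) n 2 ws"
      using leads_perturbed[OF ws(2,3) s \<alpha>\<beta> dev] by blast
    ultimately show False using no ws(1) by blast
  qed
  also have "\<dots> \<le> real (card W) * (2 / real h ^ 4) + real (card {..<n}) * (2 / real n ^ 4)"
    by (rule order_trans[OF prob_pmf_disj_le]) (intro add_mono P1 P2)
  also have "\<dots> \<le> 2 / real h + 2 / real h"
  proof (rule add_mono)
    have "real (card W) \<le> real (h\<^sup>2)" using cW by (rule of_nat_mono)
    hence "real (card W) * (2 / real h ^ 4) \<le> (real h)\<^sup>2 * (2 / real h ^ 4)" by (intro mult_right_mono) auto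
    also have "\<dots> = 2 / (real h)\<^sup>2" using h by (simp add: power4_eq_xxxx power2_eq_square)
    also have "\<dots> \<le> 2 / real h"
      using h power_increasing[of 1 2 "real h"] by (intro divide_left_mono) auto
    finally show "real (card W) * (2 / real h ^ 4) \<le> 2 / real h" .
    have "real (card {..<n}) * (2 / real n ^ 4) = 2 / real n ^ 3" using h by (simp add: power4_eq_xxxx power3_eq_cube)
    also have "\<dots> \<le> 2 / real n"
      using h power_increasing[of 1 3 "real n"] by (intro divide_left_mono) auto
    also have "\<dots> \<le> 2 / real h" using h by (intro divide_left_mono) auto
    finally show "real (card {..<n}) * (2 / real n ^ 4) \<le> 2 / real h" .
  qed
  finally show ?thesis by simp
qed

section \<open>The correlated pair as a two-stage experiment\<close>

lemma er_prob_eq_Pi_pmf: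
  assumes "\<And>x. pmf c x = cell p11 p10 p01 p00 x"
  shows "er_prob n p11 p10 p01 p00 A = measure_pmf.prob (Pi_pmf (edges n) undefined (\<lambda>_. c)) {\<omega>. A \<omega>}"
proof -
  let ?M = "Pi_pmf (edges n) undefined (\<lambda>_. c)"
  let ?E = "PiE (edges n) (\<lambda>_. UNIV) :: (nat \<times> nat \<Rightarrow> bool \<times> bool) set"
  have fin: "finite ?E" by (intro finite_PiE finite_edges) auto
  have "measure_pmf.prob ?M {\<omega>. A \<omega>} = measure_pmf.prob ?M {\<omega> \<in> ?E. A \<omega>}"
  proof (rule measure_prob_cong_0)
    fix \<omega> assume "\<omega> \<in> {\<omega>. A \<omega>} - {\<omega> \<in> ?E. A \<omega>}"
    hence "\<exists>x. x \<notin> edges n \<and> \<omega> x \<noteq> undefined" by (auto simp: PiE_def extensional_def)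
    thus "pmf ?M \<omega> = 0" by (rule pmf_Pi_outside[OF finite_edges])
  qed auto
  also have "\<dots> = (\<Sum>\<omega>\<in>{\<omega> \<in> ?E. A \<omega>}. pmf ?M \<omega>)"
    using fin by (intro measure_measure_pmf_finite) auto
  also have "\<dots> = (\<Sum>\<omega>\<in>{\<omega> \<in> ?E. A \<omega>}. \<Prod>e\<in>edges n. cell p11 p10 p01 p00 (\<omega> e))"
    by (intro sum.cong refl) (auto simp: pmf_Pi finite_edges assms PiE_def extensional_def)
  also have "\<dots> = er_prob n p11 p10 p01 p00 A"
    unfolding er_prob_def using fin by (simp add: sum.inter_filter)
  finally show ?thesis ..
qed

text \<open>\<open>\<alpha>\<close> is the conditional probability that an edge of the first graph
  is lost in the second, \<open>\<beta>\<close> that a non-edge becomes an edge.\<close>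

definition cell_pmf :: "real \<Rightarrow> real \<Rightarrow> real \<Rightarrow> (bool \<times> bool) pmf" where
  "cell_pmf p \<alpha> \<beta> = bind_pmf (bernoulli_pmf p)
     (\<lambda>a. bind_pmf (bernoulli_pmf (if a then 1 - \<alpha> else \<beta>)) (\<lambda>b. return_pmf (a, b)))"

lemma pmf_cell_pmf:
  assumes "0 \<le> p11" "0 \<le> p10" "0 \<le> p01" "0 \<le> p00" "p11 + p10 + p01 + p00 = 1" "0 < p11 + p10" "p11 + p10 < 1"
  shows "pmf (cell_pmf (p11 + p10) (p10 / (p11 + p10)) (p01 / (1 - (p11 + p10)))) x = cell p11 p10 p01 p00 x"
proof -
  define p where "p = p11 + p10"
  define \<alpha> where "\<alpha> = p10 / p"
  define \<beta> where "\<beta> = p01 / (1 - p)"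
  have p: "0 < p" "p < 1" using assms by (auto simp: p_def)
  have \<alpha>: "0 \<le> \<alpha>" "\<alpha> \<le> 1" using assms by (auto simp: p_def \<alpha>_def)
  have \<beta>: "0 \<le> \<beta>" "\<beta> \<le> 1" using assms by (auto simp: p_def \<beta>_def)
  have *: "p * \<alpha> = p10" "(1 - p) * \<beta> = p01" using p by (auto simp: \<alpha>_def \<beta>_def)
  have "p * (1 - \<alpha>) = p - p * \<alpha>" "(1 - p) * (1 - \<beta>) = 1 - p - (1 - p) * \<beta>"
    by (simp_all add: algebra_simps)
  hence **: "p * (1 - \<alpha>) = p11" "(1 - p) * (1 - \<beta>) = p00"
    unfolding * using assms(5) by (simp_all add: p_def)
  obtain a b where x: "x = (a, b)" by (cases x)
  have "pmf (cell_pmf p \<alpha> \<beta>) x = cell p11 p10 p01 p00 x"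
    using p \<alpha> \<beta> * ** unfolding x cell_pmf_def
    by (cases a; cases b) (simp_all add: pmf_bind indicator_def cell_def mult.commute)
  thus ?thesis by (simp add: p_def \<alpha>_def \<beta>_def)
qed

text \<open>The value \<open>undefined\<close> off \<open>edges n\<close> reproduces the extensional
  functions over which \<open>er_prob\<close> sums; the two single labellings have default
  \<open>False\<close>.\<close>

definition join_graphs :: "nat \<Rightarrow> (nat \<times> nat \<Rightarrow> bool) \<Rightarrow> (nat \<times> nat \<Rightarrow> bool) \<Rightarrow> nat \<times> nat \<Rightarrow> bool \<times> bool" where
  "join_graphs n a b = (\<lambda>e. if e \<in> edges n then (a e, b e) else undefined)"

text \<open>Lifts the edgewise two-stage sampling to whole graphs: with the first labelling fixed,
  the labels of the second are independent.\<close>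

lemma Pi_cell_pmf:
  "Pi_pmf (edges n) undefined (\<lambda>_. cell_pmf p \<alpha> \<beta>) =
     bind_pmf (er_pmf n p) (\<lambda>a. map_pmf (join_graphs n a)
       (Pi_pmf (edges n) False (\<lambda>e. bernoulli_pmf (if a e then 1 - \<alpha> else \<beta>))))"
  unfolding cell_pmf_def
  by (simp add: Pi_pmf_bind[where d' = False] finite_edges join_graphs_def map_pmf_def)

lemma deg_join_graphs:
  assumes "v < n"
  shows "deg n (graph_a (join_graphs n a b)) v = deg n (gr a) v"
    and "deg n (graph_b (join_graphs n a b)) v = deg n (gr b) v"
  unfolding graph_a_eq_gr graph_b_eq_gr deg_gr
  using star_subset_edges[OF assms] by (auto simp: join_graphs_def intro!: arg_cong[of _ _ card])

text \<open>First graphs that are not well spread are charged probability 1, all others the error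
  \<open>4 / h\<close> of the second stage; hence 27 = 23 + 4.\<close>

lemma er_prob_events_ge:
  fixes n h M s l :: nat and p11 p10 p01 p00 p \<alpha> \<beta> \<eta> V :: real
  assumes prob: "0 \<le> p11" "0 \<le> p10" "0 \<le> p01" "0 \<le> p00" "p11 + p10 + p01 + p00 = 1"
    and p_def: "p = p11 + p10" "\<alpha> = p10 / p" "\<beta> = p01 / (1 - p)" and p: "0 < p" "p \<le> 1/2"
    and h: "2 \<le> h" "4 * h \<le> n" and ln: "4 * ln (real n) \<le> real n * p"
    and l: "l = nat \<lfloor>real n * p + 4 * sqrt (real n * p * ln (real n))\<rfloor>"
    and \<eta>: "0 \<le> \<eta>" "\<eta> \<le> 1" "real M * \<eta> \<le> 1/2"
    and lM: "real (l + 1 + M) \<le> real (n - 2) * p * (1 + \<eta> / 2)"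
    and s: "9 \<le> s" "s + 2 \<le> M" and \<alpha>\<beta>: "\<alpha> + \<beta> \<le> 1/2"
    and V: "\<alpha> * real l + \<beta> * real n \<le> V"
    and sh: "64 * ln (real h) \<le> real s" "1024 * V * ln (real h) \<le> (real s)\<^sup>2"
    and Mn: "64 * ln (real n) \<le> real M" "1024 * V * ln (real n) \<le> (real M)\<^sup>2"
  shows "er_prob n p11 p10 p01 p00
      (\<lambda>\<omega>. event_H n h (graph_a \<omega>) (graph_b \<omega>) \<and> event_S n h (graph_a \<omega>) \<and> event_S n h (graph_b \<omega>))
    \<ge> 1 - (27 / real h + 352 * (real h)\<^sup>2 * real (2 * s + 1) / real M)" (is "er_prob n _ _ _ _ ?A \<ge> _")
proof -
  have \<alpha>\<beta>0: "0 \<le> \<alpha>" "0 \<le> \<beta>" using prob p by (auto simp: p_def(2,3))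
  obtain K where K: "measure_pmf.prob (er_pmf n p) {a. \<not> well_spread n h M s l K (deg n (gr a))}
              \<le> 23 / real h + 352 * (real h)\<^sup>2 * real (2 * s + 1) / real M"
    using er_well_spread[of h n p l \<eta> M s] assms by auto
  define second where "second = (\<lambda>a. map_pmf (join_graphs n a)
       (Pi_pmf (edges n) False (\<lambda>e. bernoulli_pmf (if a e then 1 - \<alpha> else \<beta>))))"
  let ?M = "bind_pmf (er_pmf n p) second"
  have cond: "measure_pmf.prob (second a) {\<omega>. \<not> ?A \<omega>}
      \<le> 4 / real h + 1 * indicator {a. \<not> well_spread n h M s l K (deg n (gr a))} a" for a
  proof (cases "well_spread n h M s l K (deg n (gr a))")
    case True
    let ?N = "Pi_pmf (edges n) False (\<lambda>e. bernoulli_pmf (if a e then 1 - \<alpha> else \<beta>))"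
    have "measure_pmf.prob (second a) {\<omega>. \<not> ?A \<omega>} = measure_pmf.prob ?N {b. \<not> ?A (join_graphs n a b)}"
      by (simp add: second_def vimage_def)
    also have "\<dots> \<le> measure_pmf.prob ?N {b. \<not> (\<exists>ws. length ws = h \<and> leads (deg n (gr a)) n 2 ws \<and> leads (deg n (gr b)) n 2 ws)}"
    proof (rule prob_pmf_mono, rule notI)
      fix b
      assume nA: "\<not> ?A (join_graphs n a b)"
      assume "\<exists>ws. length ws = h \<and> leads (deg n (gr a)) n 2 ws \<and> leads (deg n (gr b)) n 2 ws"
      then obtain ws where ws: "length ws = h" "leads (deg n (gr a)) n 2 ws" "leads (deg n (gr b)) n 2 ws" by blast
      have "leads (deg n (graph_a (join_graphs n a b))) n 2 ws"
        using ws(2) by (subst leads_cong[of n _ "deg n (gr a)"]) (simp_all add: deg_join_graphs)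
      moreover have "leads (deg n (graph_b (join_graphs n a b))) n 2 ws"
        using ws(3) by (subst leads_cong[of n _ "deg n (gr b)"]) (simp_all add: deg_join_graphs)
      ultimately have "?A (join_graphs n a b)"
        using leads_events ws(1) h by fastforce
      thus False using nA by blast
    qed
    also have "\<dots> \<le> 4 / real h"
      using h by (intro prob_second_graph[OF True _ _ s \<alpha>\<beta>0 \<alpha>\<beta> V sh Mn]) auto
    finally show ?thesis using True by simp
  next
    case False
    thus ?thesis using measure_pmf.prob_le_1[of "second a"] by (simp add: add_increasing)
  qed
  have "er_prob n p11 p10 p01 p00 ?A = measure_pmf.prob ?M {\<omega>. ?A \<omega>}"
    unfolding second_def Pi_cell_pmf[symmetric] using prob p unfolding p_def
    by (intro er_prob_eq_Pi_pmf pmf_cell_pmf) auto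
  also have "{\<omega>. ?A \<omega>} = space ?M - {\<omega>. \<not> ?A \<omega>}" by auto
  also have "measure_pmf.prob ?M \<dots> = 1 - measure_pmf.prob ?M {\<omega>. \<not> ?A \<omega>}"
    by (intro measure_pmf.prob_compl) auto
  finally have eq: "er_prob n p11 p10 p01 p00 ?A = 1 - measure_pmf.prob ?M {\<omega>. \<not> ?A \<omega>}" .
  have "measure_pmf.prob ?M {\<omega>. \<not> ?A \<omega>}
      \<le> 4 / real h + 1 * measure_pmf.prob (er_pmf n p) {a. \<not> well_spread n h M s l K (deg n (gr a))}"
    by (intro prob_bind_pmf_le cond)
  also have "\<dots> \<le> 4 / real h + 1 * (23 / real h + 352 * (real h)\<^sup>2 * real (2 * s + 1) / real M)"
    using K by (intro add_left_mono) simp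
  finally show ?thesis unfolding eq by simp
qed

section \<open>Choice of the parameters\<close>

text \<open>Everything is measured by \<open>q\<close>, the square root of
  \<open>n * p / ln n\<close>, and \<open>r = q / h^2\<close>. The window \<open>M\<close> is a
  multiple of \<open>q\<close> and the separation \<open>s\<close> a multiple
  \<open>\<kappa>\<close> of \<open>r\<close>, so that \<open>h^2 * s / M\<close> is of order
  \<open>\<kappa>\<close>. The last two hypotheses keep the noise below a small fraction of
  \<open>s\<close>.\<close>

lemma er_prob_events_ge_eps:
  fixes n h :: nat and p11 p10 p01 p00 p \<epsilon> d R :: real
  assumes prob: "0 \<le> p11" "0 \<le> p10" "0 \<le> p01" "0 \<le> p00" "p11 + p10 + p01 + p00 = 1"
    and p_def: "p = p11 + p10" and p: "0 < p" "p \<le> 1/2"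
    and \<epsilon>: "0 < \<epsilon>" "\<epsilon> \<le> 1" and d: "d = \<epsilon> / 38400000"
    and h: "8192 \<le> h" "54 \<le> \<epsilon> * real h" "4 * h \<le> n" "ln (real n) \<le> real h"
    and R: "R = real n * p / (real h ^ 4 * ln (real n))"
    and lnh: "(ln (real h))\<^sup>2 \<le> d\<^sup>2 * R" and \<gamma>: "real n * (p01 + p10) * ln (real h) \<le> d\<^sup>2 * R"
  shows "er_prob n p11 p10 p01 p00
      (\<lambda>\<omega>. event_H n h (graph_a \<omega>) (graph_b \<omega>) \<and> event_S n h (graph_a \<omega>) \<and> event_S n h (graph_b \<omega>))
    \<ge> 1 - \<epsilon>"
proof -
  \<comment> \<open>The coincidence error comes out as \<open>135168 * \<kappa>\<close>, which has
    to be at most \<open>\<epsilon> / 2\<close>. The further factor 128 in \<open>d\<close> provides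
    \<open>64 * d * r = \<kappa> * r / 2 \<le> s\<close>.\<close>
  define \<kappa> where "\<kappa> = \<epsilon> / 300000"
  define L where "L = ln (real n)"
  define r where "r = sqrt R"
  define q where "q = (real h)\<^sup>2 * r"
  define s where "s = nat \<lfloor>\<kappa> * r\<rfloor>"
  define M where "M = nat \<lfloor>q / 64\<rfloor>"
  define \<gamma> where "\<gamma> = real n * (p01 + p10)"
  define l where "l = nat \<lfloor>real n * p + 4 * sqrt (real n * p * ln (real n))\<rfloor>"
  have \<kappa>: "0 < \<kappa>" "\<kappa> \<le> 1" and d\<kappa>: "d = \<kappa> / 128" and d0: "0 < d" "d \<le> 1 / 128"
    using \<epsilon> by (auto simp: \<kappa>_def d)
  have n: "32768 \<le> real n" "4 * real h \<le> real n" using h(1,3) by linarith+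
  have e1: "exp 1 \<le> (8192 :: real)" using exp_le by linarith
  have lnh1: "1 \<le> ln (real h)" using e1 h(1) by (subst ln_ge_iff) auto
  have L1: "1 \<le> L" unfolding L_def using e1 n by (subst ln_ge_iff) auto
  have hh: "8192 \<le> real h" using h(1) by simp
  have R0: "0 < R" unfolding R using n p L1 hh by (auto simp: L_def intro!: divide_pos_pos mult_pos_pos)
  have r2: "r\<^sup>2 = R" using R0 by (simp add: r_def)
  have r0: "0 < r" using R0 by (simp add: r_def)
  have ln_le: "ln (real h) \<le> d * r"
    by (rule power2_le_imp_le) (use lnh r2 d0 r0 in \<open>auto simp: power_mult_distrib\<close>)
  have dr: "1 \<le> d * r" using ln_le lnh1 by linarith
  have \<kappa>r: "128 \<le> \<kappa> * r" using dr by (simp add: d\<kappa>)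
  have r1: "128 \<le> r" using \<kappa>r mult_right_mono[of \<kappa> 1 r] \<kappa> r0 by linarith
  have hq: "real h * 8192 \<le> (real h)\<^sup>2" using hh by (simp add: power2_eq_square)
  have q_ge: "(real h * 8192) * r \<le> q" unfolding q_def using hq r0 by (intro mult_right_mono) auto
  have "8192 * 8192 * r \<le> (real h * 8192) * r" using hh r0 by (intro mult_right_mono) auto
  hence q_ge_r: "8192 * 8192 * r \<le> q" using q_ge by linarith
  hence q_big: "8192 * 8192 \<le> q" using r1 by linarith
  have \<mu>: "real n * p = L * q\<^sup>2"
    using L1 hh by (simp add: q_def r2 R power_mult_distrib L_def flip: power_mult)
  have sqrt: "sqrt (real n * p * ln (real n)) = L * q"
    using L1 q_big by (simp add: \<mu> L_def[symmetric] real_sqrt_mult power2_eq_square)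
  have Lq: "q \<le> L * q" using L1 q_big mult_right_mono[of 1 L q] by simp
  have s_bounds: "real s \<le> \<kappa> * r" "\<kappa> * r / 2 \<le> real s" "9 \<le> s"
    using \<kappa>r unfolding s_def by linarith+
  have M_bounds: "real M \<le> q / 64" "q / 128 \<le> real M"
    using q_big unfolding M_def by linarith+
  have \<gamma>0: "0 \<le> \<gamma>" using prob by (simp add: \<gamma>_def)
  have \<gamma>ln: "\<gamma> * ln (real h) \<le> d\<^sup>2 * r\<^sup>2" using \<gamma> by (simp add: \<gamma>_def r2)
  have \<gamma>_le: "\<gamma> \<le> d\<^sup>2 * r\<^sup>2" using mult_left_mono[OF lnh1 \<gamma>0] \<gamma>ln by linarith
  have d2: "d\<^sup>2 \<le> 1 / 4" using power_mono[of d "1/2" 2] d0 by (simp add: power_divide)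
  \<comment> \<open>Shows that the two graphs differ little relative to \<open>p\<close>. This makes
    \<open>\<alpha>\<close> and \<open>\<beta>\<close> at most 1/4, so the conditional mean has
    slope at least 1/2.\<close>
  have "\<gamma> \<le> real n * (p / 4)"
  proof -
    have "r \<le> q" using q_ge_r r0 by linarith
    hence "r\<^sup>2 \<le> q\<^sup>2" using r0 by (intro power_mono) auto
    also have "\<dots> \<le> L * q\<^sup>2" using mult_right_mono[OF L1, of "q\<^sup>2"] by simp
    finally have "r\<^sup>2 \<le> real n * p" by (simp add: \<mu>)
    hence "d\<^sup>2 * r\<^sup>2 \<le> 1 / 4 * (real n * p)" using d2 by (intro mult_mono) auto
    thus ?thesis using \<gamma>_le by simp
  qed
  hence p_small: "p01 + p10 \<le> p / 4" using n by (simp add: \<gamma>_def)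
  have \<alpha>: "p10 / p \<le> 1 / 4" using p p_small prob by (simp add: field_simps)
  have \<beta>2: "p01 / (1 - p) \<le> 2 * p01"
  proof -
    have "p01 * 1 \<le> p01 * (2 * (1 - p))" using prob p by (intro mult_left_mono) auto
    thus ?thesis using p by (simp add: field_simps)
  qed
  have l_le: "real l \<le> L * q\<^sup>2 + 4 * (L * q)"
    unfolding l_def sqrt unfolding \<mu> by (rule of_nat_floor) (use L1 q_big in simp)
  have "1 - \<epsilon> \<le> 1 - (27 / real h + 352 * (real h)\<^sup>2 * real (2 * s + 1) / real M)"
  proof -
    have "27 / real h \<le> \<epsilon> / 2" using h(2) hh by (simp add: field_simps)
    moreover have "352 * (real h)\<^sup>2 * real (2 * s + 1) / real M \<le> \<epsilon> / 2"
    proof -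
      have "real (2 * s + 1) \<le> 3 * (\<kappa> * r)" using s_bounds by simp
      hence "352 * (real h)\<^sup>2 * real (2 * s + 1) / real M \<le> 352 * (real h)\<^sup>2 * (3 * (\<kappa> * r)) / (q / 128)"
        using M_bounds q_big by (intro frac_le mult_left_mono) auto
      also have "\<dots> = 135168 * \<kappa>" using r0 hh by (simp add: q_def field_simps)
      also have "\<dots> \<le> \<epsilon> / 2" using \<epsilon> by (simp add: \<kappa>_def)
      finally show ?thesis .
    qed
    ultimately show ?thesis by simp
  qed
  also have "\<dots> \<le> er_prob n p11 p10 p01 p00
      (\<lambda>\<omega>. event_H n h (graph_a \<omega>) (graph_b \<omega>) \<and> event_S n h (graph_a \<omega>) \<and> event_S n h (graph_b \<omega>))"
  \<comment> \<open>All degrees are bounded by \<open>l\<close>, whose excess over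
    \<open>n * p\<close> is a fraction \<open>4 / q\<close>; \<open>\<eta> / 2 = 16 / q\<close>
    covers it together with \<open>M\<close> and the loss from \<open>n\<close> to
    \<open>n - 2\<close>. The variance bound \<open>2 * \<gamma>\<close> rests on
    \<open>l \<le> 2 * n * p\<close> and \<open>1 - p \<ge> 1/2\<close>.\<close>
  proof (rule er_prob_events_ge[where \<alpha> = "p10 / p" and \<beta> = "p01 / (1 - p)" and \<eta> = "32 / q" and V = "2 * \<gamma>" and l = l])
    have "4 * L \<le> L * q\<^sup>2"
      using mult_left_mono[of 4 "q\<^sup>2" L] power_mono[of 2 q 2] L1 q_big by (simp add: mult.commute)
    thus "4 * ln (real n) \<le> real n * p" unfolding \<mu> L_def .
    show "real M * (32 / q) \<le> 1 / 2" using M_bounds(1) q_big by (simp add: field_simps)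
    show "real (l + 1 + M) \<le> real (n - 2) * p * (1 + 32 / q / 2)"
    proof -
      have "real (l + 1 + M) \<le> L * q\<^sup>2 + 6 * (L * q)"
        using l_le M_bounds(1) Lq q_big unfolding of_nat_add of_nat_1 by linarith
      also have "\<dots> \<le> L * q\<^sup>2 + 16 * (L * q) - (1 + 16 / q)"
      proof -
        have "16 / q \<le> 1" using q_big by (simp add: field_simps)
        thus ?thesis using Lq q_big by linarith
      qed
      also have "\<dots> = (L * q\<^sup>2 - 1) * (1 + 32 / q / 2)"
        using q_big by (simp add: field_simps power2_eq_square)
      also have "\<dots> \<le> (real n * p - 2 * p) * (1 + 32 / q / 2)"
        unfolding \<mu>[symmetric] using p q_big by (intro mult_right_mono) auto
      also have "real n * p - 2 * p = real (n - 2) * p" using n by (simp add: of_nat_diff algebra_simps)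
      finally show ?thesis .
    qed
    have "real s + 2 \<le> real M"
    proof -
      have "\<kappa> * r \<le> 1 * r" using \<kappa> r0 by (intro mult_right_mono) auto
      thus ?thesis using s_bounds M_bounds q_ge_r r1 by linarith
    qed
    thus "s + 2 \<le> M" by linarith
    show "p10 / p + p01 / (1 - p) \<le> 1 / 2" using \<alpha> \<beta>2 p_small prob p by linarith
    show "p10 / p * real l + p01 / (1 - p) * real n \<le> 2 * \<gamma>"
    proof -
      have "4 * (L * q) \<le> L * q\<^sup>2"
        using mult_left_mono[of 4 q "L * q"] q_big L1 by (simp add: power2_eq_square mult.assoc mult.commute mult.left_commute)
      hence "real l \<le> 2 * (real n * p)" using l_le by (simp add: \<mu>)
      hence "p10 / p * real l \<le> p10 / p * (2 * (real n * p))" using prob p by (intro mult_left_mono) auto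
      also have "\<dots> = 2 * real n * p10" using p by simp
      finally have "p10 / p * real l \<le> 2 * real n * p10" .
      moreover have "p01 / (1 - p) * real n \<le> 2 * p01 * real n" using \<beta>2 by (intro mult_right_mono) auto
      ultimately show ?thesis by (simp add: \<gamma>_def algebra_simps)
    qed
    show "64 * ln (real h) \<le> real s" using ln_le s_bounds d\<kappa> by simp
    show "1024 * (2 * \<gamma>) * ln (real h) \<le> (real s)\<^sup>2"
    proof -
      have "1024 * (2 * \<gamma>) * ln (real h) \<le> 2048 * (d\<^sup>2 * r\<^sup>2)" using \<gamma>ln by simp
      also have "\<dots> \<le> (\<kappa> * r / 2)\<^sup>2" by (simp add: d\<kappa> power_mult_distrib power_divide)
      also have "\<dots> \<le> (real s)\<^sup>2" using s_bounds \<kappa> r0 by (intro power_mono) auto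
      finally show ?thesis .
    qed
    have "real h * 1 \<le> real h * r" using r1 by (intro mult_left_mono) auto
    thus "64 * ln (real n) \<le> real M" using h(4) q_ge M_bounds(2) by linarith
    show "1024 * (2 * \<gamma>) * ln (real n) \<le> (real M)\<^sup>2"
    proof -
      \<comment> \<open>The factor \<open>ln n\<close> of the union over all vertices is paid here:
        \<open>M\<close> exceeds the scale \<open>r\<close> by a multiple of \<open>h^2\<close>,
        while \<open>ln n \<le> h\<close>.\<close>
      have "real h \<le> (real h)\<^sup>2" using hq hh by linarith
      have "\<gamma> * ln (real n) \<le> (1 / 4 * r\<^sup>2) * (real h)\<^sup>2"
      proof (intro mult_mono)
        have "d\<^sup>2 * r\<^sup>2 \<le> 1 / 4 * r\<^sup>2" using d2 by (intro mult_right_mono) auto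
        thus "\<gamma> \<le> 1 / 4 * r\<^sup>2" using \<gamma>_le by linarith
        show "ln (real n) \<le> (real h)\<^sup>2" using h(4) \<open>real h \<le> (real h)\<^sup>2\<close> by linarith
        show "0 \<le> ln (real n)" using L1 by (simp add: L_def)
      qed auto
      also have "\<dots> \<le> 2 * (r\<^sup>2 * (real h)\<^sup>2)" by simp
      finally have "1024 * (2 * \<gamma>) * ln (real n) \<le> (real h * 8192 * r / 128)\<^sup>2"
        by (simp add: power_mult_distrib power_divide mult.commute)
      also have "\<dots> \<le> (real M)\<^sup>2"
      proof (rule power_mono)
        show "real h * 8192 * r / 128 \<le> real M" using q_ge M_bounds(2) by linarith
      qed (use r0 in simp)
      finally show ?thesis .
    qed
  qed (use prob p h(1,3) q_big s_bounds(3) in \<open>auto simp: p_def l_def\<close>)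
  finally show ?thesis .
qed

theorem theorem4p7:
  fixes p11 p10 p01 p00 :: "nat \<Rightarrow> real" and h :: "nat \<Rightarrow> nat"
  assumes prob: "\<forall>n. p11 n \<ge> 0 \<and> p10 n \<ge> 0 \<and> p01 n \<ge> 0 \<and> p00 n \<ge> 0
                    \<and> p11 n + p10 n + p01 n + p00 n = 1"
    and p00: "p00 \<longlonglongrightarrow> 1"
    and h_range: "\<forall>\<^sub>F n in sequentially. 1 \<le> h n \<and> h n \<le> n"
    and h_lower: "(\<lambda>n. ln (real n)) \<in> o(\<lambda>n. real (h n))"
    and h_upper: "(\<lambda>n. real (h n)) \<in> o(\<lambda>n. real n)"
    and cond: "(\<lambda>n. max ((ln (real (h n)))\<^sup>2) (real n * (p01 n + p10 n) * ln (real (h n))))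
                 \<in> o(\<lambda>n. (real n * p11 n / (real (h n) ^ 4 * ln (real n)))
                          * (p11 n / (p11 n + p10 n)))"
  shows "\<exists>f :: nat \<Rightarrow> real. f \<in> o(\<lambda>n. 1) \<and>
           (\<forall>\<^sub>F n in sequentially.
              er_prob n (p11 n) (p10 n) (p01 n) (p00 n)
                (\<lambda>\<omega>. event_H n (h n) (graph_a \<omega>) (graph_b \<omega>)
                      \<and> event_S n (h n) (graph_a \<omega>) \<and> event_S n (h n) (graph_b \<omega>))
              \<ge> 1 - f n)"
proof -
  define P where "P = (\<lambda>n. er_prob n (p11 n) (p10 n) (p01 n) (p00 n)
                (\<lambda>\<omega>. event_H n (h n) (graph_a \<omega>) (graph_b \<omega>)
                      \<and> event_S n (h n) (graph_a \<omega>) \<and> event_S n (h n) (graph_b \<omega>)))"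
  have ev: "eventually (\<lambda>n. 1 - \<epsilon> \<le> P n) sequentially" if \<epsilon>: "0 < \<epsilon>" "\<epsilon> \<le> 1" for \<epsilon> :: real
  proof -
    define d where "d = \<epsilon> / 38400000"
    have "0 < d\<^sup>2" using \<epsilon> by (simp add: d_def)
    have e1: "eventually (\<lambda>n. norm (max ((ln (real (h n)))\<^sup>2) (real n * (p01 n + p10 n) * ln (real (h n))))
       \<le> d\<^sup>2 * norm ((real n * p11 n / (real (h n) ^ 4 * ln (real n))) * (p11 n / (p11 n + p10 n)))) sequentially"
      by (rule landau_o.smallD[OF cond \<open>0 < d\<^sup>2\<close>])
    have e2: "eventually (\<lambda>n. norm (ln (real n)) \<le> 1 * norm (real (h n))) sequentially"
      by (rule landau_o.smallD[OF h_lower]) simp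
    have e3: "eventually (\<lambda>n. norm (real (h n)) \<le> 1/4 * norm (real n)) sequentially"
      by (rule landau_o.smallD[OF h_upper]) simp
    have e4: "eventually (\<lambda>n. 1/2 < p00 n) sequentially"
      by (rule order_tendstoD[OF p00]) simp
    have "filterlim (\<lambda>n. ln (real n)) at_top sequentially"
      by (rule filterlim_compose[OF ln_at_top filterlim_real_sequentially])
    \<comment> \<open>Both thresholds pass from \<open>ln n\<close> to \<open>h\<close> through
      \<open>ln n \<le> h\<close>: they become \<open>8192 \<le> h\<close> and
      \<open>54 \<le> \<epsilon> * h\<close>.\<close>
    hence e5: "eventually (\<lambda>n. max 8192 (54 / \<epsilon>) \<le> ln (real n)) sequentially"
      unfolding filterlim_at_top by blast
    show ?thesis
      using e1 e2 e3 e4 e5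
    proof eventually_elim
      case (elim n)
      define p where "p = p11 n + p10 n"
      have pr: "0 \<le> p11 n" "0 \<le> p10 n" "0 \<le> p01 n" "0 \<le> p00 n" "p11 n + p10 n + p01 n + p00 n = 1"
        using prob by auto
      have lnn: "8192 \<le> ln (real n)" "54 / \<epsilon> \<le> ln (real n)" using elim(5) by auto
      have h: "ln (real n) \<le> real (h n)" using elim(2) by simp
      have hb: "8192 \<le> real (h n)" using h lnn by linarith
      define R where "R = real n * p / (real (h n) ^ 4 * ln (real n))"
      let ?g = "(real n * p11 n / (real (h n) ^ 4 * ln (real n))) * (p11 n / (p11 n + p10 n))"
      \<comment> \<open>For \<open>p11 n = 0\<close> the right-hand side of the growth condition
        would be 0, while its left-hand side is at least this positive square; hence
        \<open>p > 0\<close>.\<close>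
      have "0 < (ln (real (h n)))\<^sup>2" using hb by simp
      also have "\<dots> \<le> d\<^sup>2 * norm ?g" using elim(1) by (simp add: abs_le_iff)
      finally have "p11 n \<noteq> 0" by auto
      hence p11: "0 < p11 n" using pr by simp
      \<comment> \<open>Both \<open>p11 / p \<le> 1\<close> and \<open>p11 \<le> p\<close> are used,
        so the growth condition is now expressed by the edge density \<open>p\<close> of the first
        graph.\<close>
      have "?g \<le> real n * p11 n / (real (h n) ^ 4 * ln (real n)) * 1"
        using pr p11 lnn by (intro mult_left_mono) (auto simp: field_simps)
      also have "\<dots> \<le> R"
        unfolding R_def using lnn pr by (auto simp: p_def intro!: divide_right_mono mult_left_mono)
      finally have gR: "norm ?g \<le> R" using pr p11 lnn by simp
      hence "d\<^sup>2 * norm ?g \<le> d\<^sup>2 * R" by (intro mult_left_mono) auto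
      hence m: "max ((ln (real (h n)))\<^sup>2) (real n * (p01 n + p10 n) * ln (real (h n))) \<le> d\<^sup>2 * R"
        using elim(1) unfolding real_norm_def by linarith
      show ?case
        unfolding P_def
      proof (rule er_prob_events_ge_eps[where p = p and d = d and R = R])
        show "54 \<le> \<epsilon> * real (h n)" using lnn(2) h \<epsilon> by (simp add: field_simps) (smt (verit) mult_left_mono)
        show "4 * h n \<le> n" using elim(3) by simp
        show "8192 \<le> h n" using hb by simp
      qed (use pr p11 elim(4) \<epsilon> h m in \<open>auto simp: p_def d_def R_def\<close>)
    qed
  qed
  show ?thesis
  proof (intro exI conjI)
    \<comment> \<open>The positive part of the failure probability is itself the error function; it
      tends to 0 because \<open>ev\<close> holds for every fixed error.\<close>
    show "(\<lambda>n. max 0 (1 - P n)) \<in> o(\<lambda>n. 1)"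
    proof (rule landau_o.smallI)
      fix c :: real assume "0 < c"
      hence "eventually (\<lambda>n. 1 - min c 1 \<le> P n) sequentially" by (intro ev) auto
      thus "eventually (\<lambda>n. norm (max 0 (1 - P n)) \<le> c * norm (1 :: real)) sequentially"
        by eventually_elim (use \<open>0 < c\<close> in auto)
    qed
    show "\<forall>\<^sub>F n in sequentially. 1 - max 0 (1 - P n) \<le> er_prob n (p11 n) (p10 n) (p01 n) (p00 n)
                (\<lambda>\<omega>. event_H n (h n) (graph_a \<omega>) (graph_b \<omega>)
                      \<and> event_S n (h n) (graph_a \<omega>) \<and> event_S n (h n) (graph_b \<omega>))"
      by (rule always_eventually) (auto simp: P_def)
  qed
qed

end
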